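(* Let $K\in\mathcal T$ be an unknown matrix whose principal minors $a_J=\det(K_J)$, $J\subseteq[N]$, are available. Assume that $K_{i,j}\neq 0$ for all $i\neq j$, and that for all pairwise distinct $i,j,k,l\in[N]$ and all $\eta_1,\eta_2,\eta_3\in\{-1,0,1\}$, $$\eta_1 K_{i,j}K_{j,k}K_{k,l}K_{l,i}+\eta_2 K_{i,j}K_{j,l}K_{l,k}K_{k,i}+\eta_3 K_{i,k}K_{k,j}K_{j,l}K_{l,i}=0\ \Longrightarrow\ \eta_1=\eta_2=\eta_3=0.$$ Then Algorithm A (described in the context) finds, in polynomial time in $N$, a matrix $H\in\mathcal T$ such that $\det(H_J)=\det(K_J)$ for all nonempty $J\subseteq[N]$.
   Context: $[N]=\{1,\dots,N\}$. For an $N\times N$ matrix $M$ and $J\subseteq[N]$, $M_J=(M_{i,j})_{i,j\in J}$. $\mathcal T$ is the set of signed kernels: real $N\times N$ matrices $M$ such that for all $i\neq j$, $M_{j,i}=\epsilon_{i,j}M_{i,j}$ for some $\epsilon_{i,j}=\epsilon_{j,i}\in\{-1,1\}$. For an oriented cycle $\overrightarrow{C}$ of the complete graph on $[N]$, $\overrightarrow{\pi}_M(\overrightarrow{C})=\prod_{(i,j)\in\overrightarrow{C}}M_{i,j}$. For $S\subseteq[N]$ with $|S|\geq 3$, $\pi_M(S)$ denotes the sum of $\overrightarrow{\pi}_M(\overrightarrow{C})$ over all oriented cycles $\overrightarrow{C}$ with vertex set exactly $S$. $\mathbb T^+(S)$ is the set of unoriented cycles $C$ with vertex set $S$ such that the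 product over the edges $\{i,j\}$ of $C$ of the signs $\epsilon_{i,j}$ of $K$ (those with $K_{j,i}=\epsilon_{i,j}K_{i,j}$, computed in step 3 below) is $+1$; for each such $C$, $\overrightarrow{C}$ denotes an arbitrarily chosen one of the two orientations of $C$. $\mathrm{GF}_2$ is the two-element field. Algorithm A. Input: the list $\{a_J: J\subseteq[N]\}$. 1. Set $H_{i,i}=a_{\{i\}}$ for all $i=1,\dots,N$. 2. Set $|H_{i,j}|=\sqrt{|a_{\{i\}}a_{\{j\}}-a_{\{i,j\}}|}$ for all $i\neq j$. 3. Set $\epsilon_{i,j}=\mathrm{sign}(a_{\{i\}}a_{\{j\}}-a_{\{i,j\}})$ for all $i\neq j$. 4. Find the set $\mathcal J^+$ of all triples $(i,j,k)$ of pairwise distinct indices such that $\epsilon_{i,j}\epsilon_{i,k}\epsilon_{j,k}=1$, and find the sign that $H_{i,j}H_{j,k}H_{i,k}$ must have (that of $K_{i,j}K_{j,k}K_{i,k}$) for all $(i,j,k)\in\mathcal J^+$, using $a_J$, $J\subseteq\{i,j,k\}$. 5. For all $S\subseteq[N]$ of size $4$, find the value that $\pi_H(S)$ must have (that of $\pi_K(S)$) and deduce the sign of $\overrightarrow{\pi}_K(\overrightarrow{C})$ for all $C\in\mathbb T^+(S)$. 6. Find a sign assignment for the off-diagonal entries of $H$, with $H_{j,i}=\epsilon_{i,j}H_{i,j}$ for all $i\neq j$, that matches all the signs found in steps 4 and 5, by Gaussian elimination in $\mathrm{GF}_2$ (the signs $+1,-1$ being encoded as $0,1\in\mathrm{GF}_2$).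 *)

theory Defs
  imports
    Complex_Main
    "HOL-Library.Monad_Syntax"
    "HOL-Library.Z2"
    "HOL-Computational_Algebra.Polynomial"
    "Jordan_Normal_Form.Determinant"
    "Jordan_Normal_Form.DL_Submatrix"
begin

section \<open>Signed kernels and principal minors\<close>

text \<open>The index set is \<open>{..<N}\<close> instead of \<open>{1..N}\<close> throughout.\<close>

definition signed_kernels :: "nat \<Rightarrow> real mat set" where
  "signed_kernels N = {M \<in> carrier_mat N N. \<exists>\<epsilon> :: nat \<Rightarrow> nat \<Rightarrow> real.
     \<forall>i<N. \<forall>j<N. i \<noteq> j \<longrightarrow>
       \<epsilon> i j \<in> {-1, 1} \<and> \<epsilon> i j = \<epsilon> j i \<and> M $$ (j, i) = \<epsilon> i j * M $$ (i, j)}"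

definition principal_minor :: "real mat \<Rightarrow> nat set \<Rightarrow> real" where
  "principal_minor M J = det (submatrix M J J)"


section \<open>Cost model\<close>

text \<open>
  The algorithm is written as a step-counting program over exact reals. One unit is charged for
  each arithmetic operation, square root, absolute value, sign and comparison on reals, indices
  (or pairs of indices), Booleans and elements of the two-element field. Every call of a list
  function is charged one unit, which pays for the bounded number of constructor and
  pattern-matching steps of the defining equation that is used. There is no random access: tables
  are lists of lists, and looking up an entry costs as many units as there are cells traversed.
  The list of principal minors is an oracle; querying it at a set given by \<open>k\<close> indices
  costs \<open>k + 1\<close> units.
\<close>

datatype 'a timed = Timed (result: 'a) (steps: nat)

definition ret :: "'a \<Rightarrow> 'a timed" where
  "ret x = Timed x 0"

definition tick :: "unit timed" where
  "tick = Timed () 1"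

definition bind_timed :: "'a timed \<Rightarrow> ('a \<Rightarrow> 'b timed) \<Rightarrow> 'b timed" where
  "bind_timed m f =
     Timed (result (f (result m))) (steps m + steps (f (result m)))"

adhoc_overloading Monad_Syntax.bind \<rightleftharpoons> bind_timed

text \<open>A primitive unary or binary operation, applied to the results of timed computations.\<close>

definition op1 :: "('a \<Rightarrow> 'b) \<Rightarrow> 'a timed \<Rightarrow> 'b timed" where
  "op1 f m = do {x \<leftarrow> m; tick; ret (f x)}"

definition op2 :: "('a \<Rightarrow> 'b \<Rightarrow> 'c) \<Rightarrow> 'a timed \<Rightarrow> 'b timed \<Rightarrow> 'c timed" where
  "op2 f m n = do {x \<leftarrow> m; y \<leftarrow> n; tick; ret (f x y)}"

instantiation timed :: (plus) plus
begin
definition plus_timed :: "'a timed \<Rightarrow> 'a timed \<Rightarrow> 'a timed" where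
  "plus_timed = op2 (+)"
instance ..
end

instantiation timed :: (minus) minus
begin
definition minus_timed :: "'a timed \<Rightarrow> 'a timed \<Rightarrow> 'a timed" where
  "minus_timed = op2 (-)"
instance ..
end

instantiation timed :: (times) times
begin
definition times_timed :: "'a timed \<Rightarrow> 'a timed \<Rightarrow> 'a timed" where
  "times_timed = op2 (*)"
instance ..
end

definition query :: "(nat set \<Rightarrow> real) \<Rightarrow> nat list \<Rightarrow> real timed" where
  "query a js = Timed (a (set js)) (length js + 1)"


subsection \<open>List functions\<close>

primrec upt_acc_timed :: "nat \<Rightarrow> nat list \<Rightarrow> nat list timed" where
  "upt_acc_timed 0 acc = do {tick; ret acc}"
| "upt_acc_timed (Suc n) acc = do {tick; upt_acc_timed n (n # acc)}"

primrec append_timed :: "'a list \<Rightarrow> 'a list \<Rightarrow> 'a list timed" where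
  "append_timed [] ys = do {tick; ret ys}"
| "append_timed (x # xs) ys = do {tick; zs \<leftarrow> append_timed xs ys; ret (x # zs)}"

primrec map_timed :: "('a \<Rightarrow> 'b timed) \<Rightarrow> 'a list \<Rightarrow> 'b list timed" where
  "map_timed f [] = do {tick; ret []}"
| "map_timed f (x # xs) = do {tick; y \<leftarrow> f x; ys \<leftarrow> map_timed f xs; ret (y # ys)}"

primrec concat_map_timed :: "('a \<Rightarrow> 'b list timed) \<Rightarrow> 'a list \<Rightarrow> 'b list timed" where
  "concat_map_timed f [] = do {tick; ret []}"
| "concat_map_timed f (x # xs) =
     do {tick; ys \<leftarrow> f x; zs \<leftarrow> concat_map_timed f xs; append_timed ys zs}"

primrec filter_timed :: "('a \<Rightarrow> bool timed) \<Rightarrow> 'a list \<Rightarrow> 'a list timed" where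
  "filter_timed P [] = do {tick; ret []}"
| "filter_timed P (x # xs) =
     do {tick; b \<leftarrow> P x; ys \<leftarrow> filter_timed P xs; ret (if b then x # ys else ys)}"

primrec zip_timed :: "'a list \<Rightarrow> 'b list \<Rightarrow> ('a \<times> 'b) list timed" where
  "zip_timed [] ys = do {tick; ret []}"
| "zip_timed (x # xs) ys =
     do {tick; case ys of [] \<Rightarrow> ret []
               | y # ys' \<Rightarrow> do {zs \<leftarrow> zip_timed xs ys'; ret ((x, y) # zs)}}"

primrec nth_timed :: "'a list \<Rightarrow> nat \<Rightarrow> 'a timed" where
  "nth_timed [] n = do {tick; ret undefined}"
| "nth_timed (x # xs) n =
     do {tick; case n of 0 \<Rightarrow> ret x | Suc m \<Rightarrow> nth_timed xs m}"

primrec member_timed :: "'a list \<Rightarrow> 'a \<Rightarrow> bool timed" where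
  "member_timed [] y = do {tick; ret False}"
| "member_timed (x # xs) y =
     do {tick; b \<leftarrow> op2 (=) (ret x) (ret y); if b then ret True else member_timed xs y}"

primrec assoc_timed :: "('a \<times> 'b) list \<Rightarrow> 'a \<Rightarrow> 'b timed" where
  "assoc_timed [] y = do {tick; ret undefined}"
| "assoc_timed (p # ps) y =
     do {tick; b \<leftarrow> op2 (=) (ret (fst p)) (ret y);
         if b then ret (snd p) else assoc_timed ps y}"

definition when_timed :: "bool timed \<Rightarrow> 'a list timed \<Rightarrow> 'a list timed" where
  "when_timed c m = do {b \<leftarrow> c; if b then m else ret []}"

definition table_timed :: "nat list \<Rightarrow> (nat \<Rightarrow> nat \<Rightarrow> 'a timed) \<Rightarrow> 'a list list timed" where
  "table_timed idx f = map_timed (\<lambda>i. map_timed (f i) idx) idx"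

definition entry :: "'a list list \<Rightarrow> nat \<Rightarrow> nat \<Rightarrow> 'a timed" where
  "entry M i j = do {r \<leftarrow> nth_timed M i; nth_timed r j}"


section \<open>Gaussian elimination over the two-element field\<close>

text \<open>A pair \<open>(cs, b)\<close> stands for the equation whose coefficients, in the order of the
  list of unknowns, are \<open>cs\<close> and whose right-hand side is \<open>b\<close>.\<close>

type_synonym equation = "bit list \<times> bit"

primrec add_coeffs :: "bit list \<Rightarrow> bit list \<Rightarrow> bit list timed" where
  "add_coeffs [] ds = do {tick; ret []}"
| "add_coeffs (c # cs) ds =
     do {tick; case ds of [] \<Rightarrow> ret []
               | d # ds' \<Rightarrow> do {e \<leftarrow> ret c + ret d; es \<leftarrow> add_coeffs cs ds'; ret (e # es)}}"

definition add_equation :: "equation \<Rightarrow> equation \<Rightarrow> equation timed" where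
  "add_equation r s =
     do {cs \<leftarrow> add_coeffs (fst r) (fst s); b \<leftarrow> ret (snd r) + ret (snd s); ret (cs, b)}"

primrec eval_coeffs :: "bit list \<Rightarrow> ('v \<times> bit) list \<Rightarrow> bit timed" where
  "eval_coeffs [] sol = do {tick; ret 0}"
| "eval_coeffs (c # cs) sol =
     do {tick; case sol of [] \<Rightarrow> ret 0
               | p # ps \<Rightarrow> ret c * ret (snd p) + eval_coeffs cs ps}"

text \<open>Separates the equations according to their leading coefficient, which is removed.\<close>

primrec split_equations :: "equation list \<Rightarrow> (equation list \<times> equation list) timed" where
  "split_equations [] = do {tick; ret ([], [])}"
| "split_equations (r # rs) =
     do {tick;
         (ones, zeros) \<leftarrow> split_equations rs;
         case fst r of
           [] \<Rightarrow> ret (ones, zeros)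
         | c # cs \<Rightarrow>
             do {b \<leftarrow> op2 (=) (ret c) (ret 1);
                 if b then ret ((cs, snd r) # ones, zeros)
                 else ret (ones, (cs, snd r) # zeros)}}"

text \<open>Elimination and back substitution; free unknowns receive the value \<open>0\<close>. If the
  system is inconsistent, the assignment that is returned is not a solution.\<close>

primrec gauss :: "'v list \<Rightarrow> equation list \<Rightarrow> ('v \<times> bit) list timed" where
  "gauss [] eqs = do {tick; ret []}"
| "gauss (v # vs) eqs =
     do {tick;
         (ones, zeros) \<leftarrow> split_equations eqs;
         case ones of
           [] \<Rightarrow> do {sol \<leftarrow> gauss vs zeros; ret ((v, 0) # sol)}
         | pivot # others \<Rightarrow>
             do {reduced \<leftarrow> map_timed (add_equation pivot) others;
                 rest \<leftarrow> append_timed reduced zeros;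
                 sol \<leftarrow> gauss vs rest;
                 x \<leftarrow> ret (snd pivot) + eval_coeffs (fst pivot) sol;
                 ret ((v, x) # sol)}}"


section \<open>Cycle sums from principal minors\<close>

text \<open>If the oracle \<open>a\<close> holds the principal minors of \<open>K\<close>, the next function
  returns \<open>K\<^bsub>i,j\<^esub> K\<^bsub>j,i\<^esub>\<close>.\<close>

definition edge_weight :: "(nat set \<Rightarrow> real) \<Rightarrow> nat \<Rightarrow> nat \<Rightarrow> real timed" where
  "edge_weight a i j = query a [i] * query a [j] - query a [i, j]"

text \<open>The sums \<open>\<pi>\<^bsub>K\<^esub>({i,j,k})\<close> and \<open>\<pi>\<^bsub>K\<^esub>({i,j,k,l})\<close> of the products of
  entries over all oriented Hamiltonian cycles. They are obtained by solving for them the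
  Leibniz expansions of the minors on \<open>{i,j,k}\<close> and on \<open>{i,j,k,l}\<close>, the permutations
  being grouped by cycle type: the 3-cycles are even and the 4-cycles are odd.\<close>

definition cycle_sum3 :: "(nat set \<Rightarrow> real) \<Rightarrow> nat \<Rightarrow> nat \<Rightarrow> nat \<Rightarrow> real timed" where
  "cycle_sum3 a i j k =
     query a [i, j, k]
     - query a [i] * query a [j] * query a [k]
     + edge_weight a i j * query a [k]
     + edge_weight a i k * query a [j]
     + edge_weight a j k * query a [i]"

definition cycle_sum4 :: "(nat set \<Rightarrow> real) \<Rightarrow> nat \<Rightarrow> nat \<Rightarrow> nat \<Rightarrow> nat \<Rightarrow> real timed" where
  "cycle_sum4 a i j k l =
     query a [i] * query a [j] * query a [k] * query a [l]
     - edge_weight a i j * query a [k] * query a [l]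
     - edge_weight a i k * query a [j] * query a [l]
     - edge_weight a i l * query a [j] * query a [k]
     - edge_weight a j k * query a [i] * query a [l]
     - edge_weight a j l * query a [i] * query a [k]
     - edge_weight a k l * query a [i] * query a [j]
     + edge_weight a i j * edge_weight a k l
     + edge_weight a i k * edge_weight a j l
     + edge_weight a i l * edge_weight a j k
     + cycle_sum3 a i j k * query a [l]
     + cycle_sum3 a i j l * query a [k]
     + cycle_sum3 a i k l * query a [j]
     + cycle_sum3 a j k l * query a [i]
     - query a [i, j, k, l]"


section \<open>The algorithm\<close>

definition diagonal_step :: "(nat set \<Rightarrow> real) \<Rightarrow> nat list \<Rightarrow> real list timed" where
  "diagonal_step a idx = map_timed (\<lambda>i. query a [i]) idx"

text \<open>The diagonal entries of the next two tables are dummies.\<close>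

definition modulus_step :: "(nat set \<Rightarrow> real) \<Rightarrow> nat list \<Rightarrow> real list list timed" where
  "modulus_step a idx = table_timed idx (\<lambda>i j.
     do {b \<leftarrow> op2 (=) (ret i) (ret j);
         if b then ret 0 else op1 sqrt (op1 abs (edge_weight a i j))})"

definition sign_step :: "(nat set \<Rightarrow> real) \<Rightarrow> nat list \<Rightarrow> real list list timed" where
  "sign_step a idx = table_timed idx (\<lambda>i j.
     do {b \<leftarrow> op2 (=) (ret i) (ret j);
         if b then ret 0 else op1 sgn (edge_weight a i j)})"

definition distinct3 :: "nat \<Rightarrow> nat \<Rightarrow> nat \<Rightarrow> bool timed" where
  "distinct3 i j k =
     op2 (\<and>) (op2 (\<noteq>) (ret i) (ret j))
       (op2 (\<and>) (op2 (\<noteq>) (ret i) (ret k)) (op2 (\<noteq>) (ret j) (ret k)))"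

text \<open>On a triple \<open>(i,j,k)\<close> with sign product \<open>1\<close>, both oriented cycles contribute
  \<open>K\<^bsub>i,j\<^esub> K\<^bsub>j,k\<^esub> K\<^bsub>k,i\<^esub> = \<epsilon>\<^bsub>i,k\<^esub> K\<^bsub>i,j\<^esub> K\<^bsub>j,k\<^esub> K\<^bsub>i,k\<^esub>\<close> to the cycle sum.\<close>

definition triple_step ::
    "(nat set \<Rightarrow> real) \<Rightarrow> nat list \<Rightarrow> real list list
      \<Rightarrow> ((nat \<times> nat \<times> nat) \<times> real) list timed" where
  "triple_step a idx E =
     concat_map_timed (\<lambda>i. concat_map_timed (\<lambda>j. concat_map_timed (\<lambda>k.
       when_timed (distinct3 i j k)
         (when_timed (op2 (=) (entry E i j * entry E i k * entry E j k) (ret 1))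
           (do {s \<leftarrow> entry E i k * op1 sgn (cycle_sum3 a i j k);
                ret [((i, j, k), s)]}))) idx) idx) idx"

type_synonym cycle4 = "nat \<times> nat \<times> nat \<times> nat"

text \<open>The product of the entries of \<open>M\<close> along the oriented cycle
  \<open>i \<rightarrow> j \<rightarrow> k \<rightarrow> l \<rightarrow> i\<close>.\<close>

definition cycle_prod4 :: "real list list \<Rightarrow> cycle4 \<Rightarrow> real timed" where
  "cycle_prod4 M = (\<lambda>(i, j, k, l). entry M i j * entry M j k * entry M k l * entry M l i)"

text \<open>Exhaustive search for signs \<open>s\<close> such that the signed sum of the list \<open>ms\<close>
  is \<open>p\<close>. The number of steps is exponential in the length of \<open>ms\<close>; below, this
  length is at most \<open>3\<close>.\<close>

primrec find_signs :: "real list \<Rightarrow> real \<Rightarrow> real list option timed" where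
  "find_signs [] p =
     do {tick; b \<leftarrow> op2 (=) (ret p) (ret 0); ret (if b then Some [] else None)}"
| "find_signs (m # ms) p =
     do {tick;
         q \<leftarrow> ret p - ret m;
         r \<leftarrow> find_signs ms q;
         case r of
           Some s \<Rightarrow> ret (Some (1 # s))
         | None \<Rightarrow>
             do {q' \<leftarrow> ret p + ret m;
                 r' \<leftarrow> find_signs ms q';
                 case r' of
                   Some s \<Rightarrow> ret (Some (-1 # s))
                 | None \<Rightarrow> ret None}}"

text \<open>In a cycle with sign product \<open>1\<close> the two orientations have equal products, and in the
  others they cancel. So the cycle sum on \<open>S\<close> is the sum, over the unoriented cycles on
  \<open>S\<close> with sign product \<open>1\<close>, of twice the product along either orientation.\<close>

definition quadruple_signs ::
    "(nat set \<Rightarrow> real) \<Rightarrow> real list list \<Rightarrow> real list list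
      \<Rightarrow> nat \<Rightarrow> nat \<Rightarrow> nat \<Rightarrow> nat \<Rightarrow> (cycle4 \<times> real) list timed" where
  "quadruple_signs a M E i j k l =
     do {pos \<leftarrow> filter_timed (\<lambda>C. op2 (=) (cycle_prod4 E C) (ret 1))
           [(i, j, k, l), (i, j, l, k), (i, k, j, l)];
         ms \<leftarrow> map_timed (\<lambda>C. ret 2 * cycle_prod4 M C) pos;
         p \<leftarrow> cycle_sum4 a i j k l;
         r \<leftarrow> find_signs ms p;
         case r of None \<Rightarrow> ret [] | Some s \<Rightarrow> zip_timed pos s}"

definition increasing4 :: "nat \<Rightarrow> nat \<Rightarrow> nat \<Rightarrow> nat \<Rightarrow> bool timed" where
  "increasing4 i j k l =
     op2 (\<and>) (op2 (<) (ret i) (ret j))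
       (op2 (\<and>) (op2 (<) (ret j) (ret k)) (op2 (<) (ret k) (ret l)))"

definition quadruple_step ::
    "(nat set \<Rightarrow> real) \<Rightarrow> nat list \<Rightarrow> real list list \<Rightarrow> real list list
      \<Rightarrow> (cycle4 \<times> real) list timed" where
  "quadruple_step a idx M E =
     concat_map_timed (\<lambda>i. concat_map_timed (\<lambda>j. concat_map_timed (\<lambda>k. concat_map_timed (\<lambda>l.
       when_timed (increasing4 i j k l) (quadruple_signs a M E i j k l)) idx) idx) idx) idx"

definition encode_sign :: "real \<Rightarrow> bit timed" where
  "encode_sign s = do {b \<leftarrow> op2 (<) (ret s) (ret 0); ret (if b then 1 else 0)}"

definition decode_sign :: "bit \<Rightarrow> real timed" where
  "decode_sign x = do {b \<leftarrow> op2 (=) (ret x) (ret 0); ret (if b then 1 else -1)}"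

text \<open>The equation stating that the signs of the entries at the positions \<open>es\<close>, which are
  pairwise different, have product \<open>s\<close>. The unknown at \<open>(i,j)\<close> is the sign of
  \<open>H\<^bsub>i,j\<^esub>\<close>.\<close>

definition sign_equation :: "(nat \<times> nat) list \<Rightarrow> (nat \<times> nat) list \<Rightarrow> real \<Rightarrow> equation timed" where
  "sign_equation unknowns es s =
     do {cs \<leftarrow> map_timed (\<lambda>e. do {b \<leftarrow> member_timed es e; ret (if b then 1 else 0)}) unknowns;
         x \<leftarrow> encode_sign s;
         ret (cs, x)}"

definition assignment_step ::
    "nat list \<Rightarrow> real list list \<Rightarrow> ((nat \<times> nat \<times> nat) \<times> real) list
      \<Rightarrow> (cycle4 \<times> real) list \<Rightarrow> ((nat \<times> nat) \<times> bit) list timed" where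
  "assignment_step idx E triples cycles =
     do {unknowns \<leftarrow> concat_map_timed (\<lambda>i. concat_map_timed (\<lambda>j.
           when_timed (op2 (\<noteq>) (ret i) (ret j)) (ret [(i, j)])) idx) idx;
         symmetry_eqs \<leftarrow> map_timed (\<lambda>(i, j).
           do {e \<leftarrow> entry E i j; sign_equation unknowns [(i, j), (j, i)] e}) unknowns;
         triple_eqs \<leftarrow> map_timed (\<lambda>((i, j, k), s).
           sign_equation unknowns [(i, j), (j, k), (i, k)] s) triples;
         cycle_eqs \<leftarrow> map_timed (\<lambda>((i, j, k, l), s).
           sign_equation unknowns [(i, j), (j, k), (k, l), (l, i)] s) cycles;
         eqs \<leftarrow> append_timed triple_eqs cycle_eqs;
         eqs' \<leftarrow> append_timed symmetry_eqs eqs;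
         gauss unknowns eqs'}"

text \<open>The output is the list of the rows of \<open>H\<close>.\<close>

definition algorithm_A :: "nat \<Rightarrow> (nat set \<Rightarrow> real) \<Rightarrow> real list list timed" where
  "algorithm_A N a =
     do {idx \<leftarrow> upt_acc_timed N [];
         D \<leftarrow> diagonal_step a idx;
         M \<leftarrow> modulus_step a idx;
         E \<leftarrow> sign_step a idx;
         triples \<leftarrow> triple_step a idx E;
         cycles \<leftarrow> quadruple_step a idx M E;
         sol \<leftarrow> assignment_step idx E triples cycles;
         table_timed idx (\<lambda>i j.
           do {b \<leftarrow> op2 (=) (ret i) (ret j);
               if b then nth_timed D i
               else do {x \<leftarrow> assoc_timed sol (i, j); decode_sign x * entry M i j}})}"

end

theory Submission
  imports Defs
begin

text \<open>
  Why the algorithm is correct. Write \<open>H i j = \<sigma> i j * K i j\<close> off the diagonal.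
  The moduli and the signs \<open>\<epsilon>\<close> can be read off the minors of size at most two,
  and the symmetry constraints make \<open>\<sigma>\<close> a symmetric sign function on the edges
  of the complete graph. Call a cycle positive if the product of \<open>\<epsilon>\<close> over its
  edges is \<open>1\<close>. Reversing a cycle multiplies its product by that sign, so the cycle
  sums on three and on four vertices, which are obtained from the minors of size at most four, only
  see the positive cycles. On three vertices this yields the sign of a positive triangle at once. On
  four vertices up to three unoriented cycles are positive, and the genericity assumption guarantees
  that their signs can be recovered from the sum of their products (lemma
  \<open>find_signs_unique\<close>). The signs of \<open>K\<close> solve all the resulting
  constraints, hence Gaussian elimination finds a solution (\<open>gauss_solves\<close>), and
  \<open>\<sigma>\<close> is \<open>1\<close> on positive triangles and positive 4-cycles
  (\<open>matched\<close>).

  It remains to see that this forces all principal minors to agree. Two negative triangles with a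
  common edge have a positive 4-cycle as their boundary, so they have the same
  \<open>\<sigma>\<close>-sign. Any two negative triangles with a common vertex are connected
  through at most two further negative triangles, neighbours sharing an edge
  (\<open>agree_at_vertex\<close>). Therefore all negative triangles at a fixed vertex have the same
  \<open>\<sigma>\<close>-sign. If it is \<open>1\<close>, then \<open>\<sigma>\<close> is trivial
  on all triangles at that vertex, hence a coboundary, and \<open>H = D K D\<close> for a diagonal
  matrix \<open>D\<close> of signs. If it is \<open>-1\<close>, the same holds for \<open>\<sigma> *
  \<epsilon>\<close>, and \<open>H = D K\<^sup>T D\<close>. Neither conjugation by \<open>D\<close>
  nor transposition changes a principal minor (\<open>principal_minors_eq_of_matched_signs\<close>).

  The running time is bounded by counting: the loops have depth at most four, and the linear system
  has \<open>O(N\<^sup>2)\<close> unknowns and \<open>O(N\<^sup>4)\<close> equations.\<close>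

section \<open>Sign functions on a complete graph\<close>

definition triangle :: "(nat \<Rightarrow> nat \<Rightarrow> real) \<Rightarrow> nat \<Rightarrow> nat \<Rightarrow> nat \<Rightarrow> real" where
  "triangle s i j k = s i j * s j k * s i k"

definition edge_signs :: "nat set \<Rightarrow> (nat \<Rightarrow> nat \<Rightarrow> real) \<Rightarrow> bool" where
  "edge_signs V s \<longleftrightarrow>
     (\<forall>i\<in>V. \<forall>j\<in>V. i \<noteq> j \<longrightarrow> s i j \<in> {-1, 1} \<and> s j i = s i j)"

lemma edge_signsD:
  assumes "edge_signs V s" "i \<in> V" "j \<in> V" "i \<noteq> j"
  shows "s i j = 1 \<or> s i j = -1" "s j i = s i j"
  using assms unfolding edge_signs_def by blast+

lemma edge_signs_mult:
  assumes "edge_signs V s" "edge_signs V t"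
  shows "edge_signs V (\<lambda>i j. s i j * t i j)"
  using assms unfolding edge_signs_def by fastforce

lemma triangle_mult: "triangle (\<lambda>i j. s i j * t i j) i j k = triangle s i j k * triangle t i j k"
  by (simp add: triangle_def)

lemma triangle_cases:
  assumes "edge_signs V s" "i \<in> V" "j \<in> V" "k \<in> V" "distinct [i, j, k]"
  shows "triangle s i j k = 1 \<or> triangle s i j k = -1"
  using edge_signsD[OF assms(1), of i j] edge_signsD[OF assms(1), of j k]
    edge_signsD[OF assms(1), of i k] assms(2-)
  by (auto simp: triangle_def)

lemma triangle_perm:
  assumes "edge_signs V s" "i \<in> V" "j \<in> V" "k \<in> V" "distinct [i, j, k]"
  shows "triangle s j i k = triangle s i j k" "triangle s i k j = triangle s i j k"
  using edge_signsD(2)[OF assms(1), of i j] edge_signsD(2)[OF assms(1), of j k] assms(2-)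
  by (auto simp: triangle_def)

text \<open>
  Each edge of a tetrahedron lies on exactly two of its faces, so every sign occurs squared.\<close>

lemma triangle_tetrahedron:
  assumes "edge_signs V s" "i \<in> V" "j \<in> V" "k \<in> V" "l \<in> V" "distinct [i, j, k, l]"
  shows "triangle s i j k * triangle s i j l * triangle s i k l * triangle s j k l = 1"
proof -
  have "s a b * s a b = 1" if "a \<in> {i,j,k,l}" "b \<in> {i,j,k,l}" "a \<noteq> b" for a b
    using edge_signsD[OF assms(1), of a b] assms(2-) that by auto
  then have "s i j * s i j = 1" "s i k * s i k = 1" "s i l * s i l = 1"
    "s j k * s j k = 1" "s j l * s j l = 1" "s k l * s k l = 1"
    using assms(6) by auto
  then have "(s i j * s i j) * (s i k * s i k) * (s i l * s i l) *
     (s j k * s j k) * (s j l * s j l) * (s k l * s k l) = 1" by simp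
  then show ?thesis by (simp add: triangle_def mult_ac)
qed

text \<open>
  The two triangles on the edge \<open>ij\<close> have the 4-cycle \<open>k i l j\<close> as their
  common boundary; the sign of the shared edge cancels.\<close>

lemma triangle_glue:
  assumes "edge_signs V s" "i \<in> V" "j \<in> V" "k \<in> V" "l \<in> V" "distinct [i, j, k, l]"
  shows "s k i * s i l * s l j * s j k = triangle s i j k * triangle s i j l"
proof -
  have "s i j * s i j = 1" using edge_signsD[OF assms(1), of i j] assms(2-) by auto
  moreover have "s k i = s i k" "s l j = s j l"
    using edge_signsD(2)[OF assms(1)] assms(2-) by auto
  ultimately have "s k i * s i l * s l j * s j k = (s i j * s i j) * (s i k * s i l * s j l * s j k)"
    by simp
  then show ?thesis by (simp add: triangle_def mult_ac)
qed

text \<open>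
  In the application \<open>\<epsilon>\<close> relates \<open>K\<close> to its transpose and
  \<open>\<sigma>\<close> is the quotient of the signs of \<open>H\<close> and \<open>K\<close>. The
  two axioms express that \<open>H\<close> and \<open>K\<close> agree on the triangles and 4-cycles
  whose two orientations do not cancel in a determinant.\<close>

locale matched_signs =
  fixes V :: "nat set" and \<epsilon> \<sigma> :: "nat \<Rightarrow> nat \<Rightarrow> real"
  assumes \<epsilon>: "edge_signs V \<epsilon>" and \<sigma>: "edge_signs V \<sigma>"
    and positive_triangle:
      "\<lbrakk>i \<in> V; j \<in> V; k \<in> V; distinct [i, j, k]; triangle \<epsilon> i j k = 1\<rbrakk> \<Longrightarrow> triangle \<sigma> i j k = 1"
    and positive_quadrangle:
      "\<lbrakk>i \<in> V; j \<in> V; k \<in> V; l \<in> V; distinct [i, j, k, l]; \<epsilon> i j * \<epsilon> j k * \<epsilon> k l * \<epsilon> l i = 1\<rbrakk>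
        \<Longrightarrow> \<sigma> i j * \<sigma> j k * \<sigma> k l * \<sigma> l i = 1"
begin

text \<open>
  A negative triangle is invisible in the minors of size three. However, gluing two of them along an
  edge gives a positive 4-cycle, and this determines the product of their
  \<open>\<sigma>\<close>-signs.\<close>

lemma agree_across_edge:
  assumes "i \<in> V" "j \<in> V" "k \<in> V" "l \<in> V" "distinct [i, j]" "k \<notin> {i,j}" "l \<notin> {i,j}"
    and "triangle \<epsilon> i j k = -1" "triangle \<epsilon> i j l = -1"
  shows "triangle \<sigma> i j k = triangle \<sigma> i j l"
proof (cases "k = l")
  case False
  then have d: "distinct [i, j, k, l]" "distinct [k, i, l, j]" using assms by auto
  have "\<sigma> k i * \<sigma> i l * \<sigma> l j * \<sigma> j k = 1"
    using positive_quadrangle[of k i l j] triangle_glue[OF \<epsilon>, of i j k l] d assms by simp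
  then have "triangle \<sigma> i j k * triangle \<sigma> i j l = 1"
    using triangle_glue[OF \<sigma>, of i j k l] d assms by simp
  then show ?thesis
    using triangle_cases[OF \<sigma>, of i j k] d assms by auto
qed simp

text \<open>
  Negative triangles \<open>r a b\<close> and \<open>r c d\<close> that meet only in
  \<open>r\<close> are joined by a chain of negative triangles in which neighbours share an edge. If
  one of the four triangles spanned by \<open>r\<close>, one of \<open>a, b\<close> and one of
  \<open>c, d\<close> is negative, it serves as the link. Otherwise these four are positive, and
  then the tetrahedra at \<open>r\<close> force \<open>a b c\<close> and \<open>a c d\<close> to be
  negative; the chain is \<open>r a b\<close>, \<open>a b c\<close>, \<open>a c d\<close>, \<open>r
  c d\<close>.\<close>

lemma agree_at_vertex:
  assumes r: "r \<in> V" and ab: "a \<in> V" "b \<in> V" "distinct [r, a, b]"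
    and cd: "c \<in> V" "d \<in> V" "distinct [r, c, d]"
    and neg: "triangle \<epsilon> r a b = -1" "triangle \<epsilon> r c d = -1"
  shows "triangle \<sigma> r a b = triangle \<sigma> r c d"
proof -
  have link: "triangle \<sigma> r a b = triangle \<sigma> r c d"
    if "a \<in> V" "b \<in> V" "distinct [r, a, b]" "c \<in> V" "d \<in> V" "distinct [r, c, d]"
      "triangle \<epsilon> r a b = -1" "triangle \<epsilon> r c d = -1" "b \<noteq> c" "triangle \<epsilon> r b c = -1" for a b c d
  proof -
    have "triangle \<sigma> r b a = triangle \<sigma> r b c"
      using agree_across_edge[of r b a c] triangle_perm(2)[OF \<epsilon>, of r a b] that r by auto
    moreover have "triangle \<sigma> r c b = triangle \<sigma> r c d"
      using agree_across_edge[of r c b d] triangle_perm(2)[OF \<epsilon>, of r b c] that r by auto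
    ultimately show ?thesis
      using triangle_perm(2)[OF \<sigma>, of r a b] triangle_perm(2)[OF \<sigma>, of r b c] that r by auto
  qed
  have swap: "triangle s r x y = triangle s r y x"
    if "edge_signs V s" "x \<in> V" "y \<in> V" "distinct [r, x, y]" for s x y
    using triangle_perm(2)[OF that(1), of r x y] that r by auto
  note sw = swap[OF \<epsilon>] swap[OF \<sigma>]
  consider "a = c" | "b = c" | "a = d" | "b = d" | "distinct [r, a, b, c, d]"
    using ab cd by auto
  then show ?thesis
  proof cases
    case 1
    then show ?thesis using agree_across_edge[of r a b d] assms by auto
  next
    case 2
    then show ?thesis using agree_across_edge[of r b a d] assms sw(1)[of a b] sw(2)[of a b] by auto
  next
    case 3
    then show ?thesis using agree_across_edge[of r a b c] assms sw(1)[of c d] sw(2)[of c d] by auto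
  next
    case 4
    then show ?thesis using agree_across_edge[of r b a c] assms sw(1)[of c d] sw(2)[of c d]
        sw(1)[of a b] sw(2)[of a b] by auto
  next
    case 5
    show ?thesis
    proof (cases "\<exists>x\<in>{a,b}. \<exists>y\<in>{c,d}. triangle \<epsilon> r x y = -1")
      case True
      then consider "triangle \<epsilon> r b c = -1" | "triangle \<epsilon> r b d = -1" | "triangle \<epsilon> r a c = -1"
        | "triangle \<epsilon> r a d = -1" by auto
      then show ?thesis
      proof cases
        case 1 then show ?thesis using link[of a b c d] assms 5 by auto
      next
        case 2 then show ?thesis
          using link[of a b d c] assms 5 sw(1)[of c d] sw(2)[of c d] by auto
      next
        case 3 then show ?thesis
          using link[of b a c d] assms 5 sw(1)[of a b] sw(2)[of a b] by auto
      next
        case 4 then show ?thesis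
          using link[of b a d c] assms 5 sw(1)[of a b] sw(2)[of a b]
            sw(1)[of c d] sw(2)[of c d] by auto
      qed
    next
      case False
      have pos: "triangle \<epsilon> r x y = 1" if "x \<in> {a,b}" "y \<in> {c,d}" for x y
        using triangle_cases[OF \<epsilon>, of r x y] False that assms 5 by auto
      have abc: "triangle \<epsilon> a b c = -1"
        using triangle_tetrahedron[OF \<epsilon>, of r a b c] pos[of a c] pos[of b c] neg r ab cd 5 by auto
      have acd: "triangle \<epsilon> a c d = -1"
        using triangle_tetrahedron[OF \<epsilon>, of r a c d] pos[of a c] pos[of a d] neg r ab cd 5 by auto
      note p = triangle_perm[OF \<epsilon>] triangle_perm[OF \<sigma>]
      have "triangle \<sigma> a b r = triangle \<sigma> a b c"
        using agree_across_edge[of a b r c] p(1)[of r a b] p(2)[of a r b] abc neg r ab cd 5 by auto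
      moreover have "triangle \<sigma> a c b = triangle \<sigma> a c d"
        using agree_across_edge[of a c b d] p(2)[of a b c] abc acd ab cd 5 by auto
      moreover have "triangle \<sigma> c d a = triangle \<sigma> c d r"
        using agree_across_edge[of c d a r] p(1)[of a c d] p(2)[of c a d] p(1)[of r c d] p(2)[of c r d]
          acd neg r ab cd 5 by auto
      ultimately show ?thesis
        using p(3)[of r a b] p(4)[of a r b] p(4)[of a b c] p(3)[of a c d] p(4)[of c a d]
          p(3)[of r c d] p(4)[of c r d] r ab cd 5 by auto
    qed
  qed
qed

text \<open>
  Positive triangles at \<open>r\<close> have \<open>\<sigma>\<close>-sign \<open>1\<close>, and the
  negative ones share a single \<open>\<sigma>\<close>-sign. So on the triangles at \<open>r\<close>
  either \<open>\<sigma>\<close> is constantly \<open>1\<close>, or it coincides with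
  \<open>\<epsilon>\<close>.\<close>

lemma rooted_dichotomy:
  assumes "r \<in> V"
  shows "(\<forall>i\<in>V. \<forall>j\<in>V. distinct [r, i, j] \<longrightarrow> triangle \<sigma> r i j = 1) \<or>
    (\<forall>i\<in>V. \<forall>j\<in>V. distinct [r, i, j] \<longrightarrow> triangle (\<lambda>i j. \<sigma> i j * \<epsilon> i j) r i j = 1)"
proof (rule disjCI)
  assume "\<not> (\<forall>i\<in>V. \<forall>j\<in>V. distinct [r, i, j] \<longrightarrow> triangle (\<lambda>i j. \<sigma> i j * \<epsilon> i j) r i j = 1)"
  then obtain a b where ab: "a \<in> V" "b \<in> V" "distinct [r, a, b]"
    and "triangle \<sigma> r a b * triangle \<epsilon> r a b \<noteq> 1" by (auto simp: triangle_mult)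
  then have "triangle \<epsilon> r a b = -1" "triangle \<sigma> r a b = 1"
    using positive_triangle[of r a b] triangle_cases[OF \<epsilon>, of r a b]
      triangle_cases[OF \<sigma>, of r a b] \<open>r \<in> V\<close> by auto
  then have "triangle \<sigma> r i j = 1" if "i \<in> V" "j \<in> V" "distinct [r, i, j]" for i j
    using agree_at_vertex[of r a b i j] positive_triangle[of r i j]
      triangle_cases[OF \<epsilon>, of r i j] \<open>r \<in> V\<close> ab that by metis
  then show "\<forall>i\<in>V. \<forall>j\<in>V. distinct [r, i, j] \<longrightarrow> triangle \<sigma> r i j = 1" by blast
qed

end

text \<open>
  The triangles at one vertex generate all cycles of a complete graph. A sign function that is
  trivial on them is thus a coboundary, and \<open>d i = s r i\<close> is a potential for it.\<close>

lemma coboundary: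
  assumes s: "edge_signs V s" and r: "r \<in> V"
    and tri: "\<And>i j. i \<in> V \<Longrightarrow> j \<in> V \<Longrightarrow> distinct [r, i, j] \<Longrightarrow> triangle s r i j = 1"
  obtains d :: "nat \<Rightarrow> real" where "\<And>i. i \<in> V \<Longrightarrow> d i = 1 \<or> d i = -1"
    and "\<And>i j. i \<in> V \<Longrightarrow> j \<in> V \<Longrightarrow> i \<noteq> j \<Longrightarrow> s i j = d i * d j"
proof
  define d where "d i = (if i = r then 1 else s r i)" for i
  show "d i = 1 \<or> d i = -1" if "i \<in> V" for i
    using edge_signsD(1)[OF s r that] by (auto simp: d_def)
  show "s i j = d i * d j" if "i \<in> V" "j \<in> V" "i \<noteq> j" for i j
  proof (cases "i = r \<or> j = r")
    case True
    then show ?thesis using edge_signsD(2)[OF s r, of i] that by (auto simp: d_def)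
  next
    case False
    then have "s r i * s i j * s r j = 1" using tri[of i j] that by (auto simp: triangle_def)
    then show ?thesis
      using edge_signsD(1)[OF s r, of i] edge_signsD(1)[OF s r, of j] that False
      by (auto simp: d_def)
  qed
qed

section \<open>Sign changes and transposition preserve principal minors\<close>

lemma principal_minor_pick:
  assumes "M \<in> carrier_mat N N" "J \<subseteq> {..<N}"
  shows "principal_minor M J = det (mat (card J) (card J) (\<lambda>(a, b). M $$ (pick J a, pick J b)))"
    and "a < card J \<Longrightarrow> pick J a \<in> J"
proof -
  have "{i. i < N \<and> i \<in> J} = J" using assms(2) by auto
  then show "principal_minor M J = det (mat (card J) (card J) (\<lambda>(a, b). M $$ (pick J a, pick J b)))"
    using assms(1) by (simp add: principal_minor_def submatrix_def)
qed (simp add: pick_in_set)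

lemma principal_minor_transpose:
  assumes "M \<in> carrier_mat N N" "J \<subseteq> {..<N}"
  shows "principal_minor (transpose_mat M) J = principal_minor M J"
proof -
  let ?A = "mat (card J) (card J) (\<lambda>(a, b). M $$ (pick J a, pick J b))"
  have "mat (card J) (card J) (\<lambda>(a, b). transpose_mat M $$ (pick J a, pick J b)) = transpose_mat ?A"
    using principal_minor_pick(2)[OF assms] assms by (intro eq_matI) (auto simp: subset_iff)
  then show ?thesis
    using principal_minor_pick(1)[OF assms] principal_minor_pick(1)[OF transpose_carrier_mat[THEN iffD2, OF assms(1)] assms(2)]
      det_transpose[of ?A "card J"] by simp
qed

text \<open>
  In the Leibniz expansion every permutation meets each row and each column once, so the signs
  \<open>d\<close> occur squared.\<close>

lemma principal_minor_sign_conjugate: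
  fixes d :: "nat \<Rightarrow> real"
  assumes M: "M \<in> carrier_mat N N" and H: "H \<in> carrier_mat N N" and J: "J \<subseteq> {..<N}"
    and d: "\<And>i. i < N \<Longrightarrow> d i = 1 \<or> d i = -1"
    and eq: "\<And>i j. i < N \<Longrightarrow> j < N \<Longrightarrow> H $$ (i, j) = d i * d j * M $$ (i, j)"
  shows "principal_minor H J = principal_minor M J"
proof -
  let ?n = "card J" and ?p = "pick J"
  have pN: "?p a < N" if "a < ?n" for a
    using principal_minor_pick(2)[OF M J that] J by auto
  have sq: "(\<Prod>a=0..<?n. d (?p a)) * (\<Prod>a=0..<?n. d (?p a)) = 1"
  proof -
    have "d (?p a) * d (?p a) = 1" if "a \<in> {0..<?n}" for a
      using d[OF pN, of a] that by auto
    then show ?thesis by (simp add: prod.distrib[symmetric])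
  qed
  let ?H = "mat ?n ?n (\<lambda>(a, b). H $$ (?p a, ?p b))" and ?M = "mat ?n ?n (\<lambda>(a, b). M $$ (?p a, ?p b))"
  have "(\<Prod>a=0..<?n. ?H $$ (a, q a)) = (\<Prod>a=0..<?n. ?M $$ (a, q a))" if q: "q permutes {0..<?n}" for q
  proof -
    have qn: "q a < ?n" if "a < ?n" for a using permutes_in_image[OF q, of a] that by simp
    have "(\<Prod>a=0..<?n. ?H $$ (a, q a)) =
        (\<Prod>a=0..<?n. d (?p a) * d (?p (q a)) * M $$ (?p a, ?p (q a)))"
      by (intro prod.cong) (auto simp: qn eq pN)
    also have "\<dots> = (\<Prod>a=0..<?n. M $$ (?p a, ?p (q a)))"
      using prod.permute[OF q, of "\<lambda>a. d (?p a)"] sq by (simp add: prod.distrib comp_def)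
    also have "\<dots> = (\<Prod>a=0..<?n. ?M $$ (a, q a))"
      by (intro prod.cong) (auto simp: qn)
    finally show ?thesis .
  qed
  then have "det ?H = det ?M"
    by (subst (1 2) det_def'[of _ ?n]) (auto intro!: sum.cong)
  then show ?thesis
    by (simp only: principal_minor_pick(1)[OF M J] principal_minor_pick(1)[OF H J])
qed

text \<open>
  The triangles at one vertex decide. If \<open>\<sigma>\<close> is trivial on all of them, \<open>H = D K D\<close>, and
  otherwise \<open>H = D K\<^sup>T D\<close>, for a diagonal matrix \<open>D\<close> of signs.\<close>

lemma principal_minors_eq_of_matched_signs:
  assumes K: "K \<in> carrier_mat N N" and H: "H \<in> carrier_mat N N" and J: "J \<subseteq> {..<N}"
    and matched: "matched_signs {..<N} \<epsilon> \<sigma>"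
    and diag: "\<And>i. i < N \<Longrightarrow> H $$ (i, i) = K $$ (i, i)"
    and KT: "\<And>i j. i < N \<Longrightarrow> j < N \<Longrightarrow> i \<noteq> j \<Longrightarrow> K $$ (j, i) = \<epsilon> i j * K $$ (i, j)"
    and HK: "\<And>i j. i < N \<Longrightarrow> j < N \<Longrightarrow> i \<noteq> j \<Longrightarrow> H $$ (i, j) = \<sigma> i j * K $$ (i, j)"
  shows "principal_minor H J = principal_minor K J"
proof (cases "N = 0")
  case True
  then show ?thesis using J K H by (simp add: principal_minor_def submatrix_def)
next
  case False
  interpret matched_signs "{..<N}" \<epsilon> \<sigma> by fact
  have r: "0 \<in> {..<N}" using False by simp
  from rooted_dichotomy[OF r] show ?thesis
  proof
    assume *: "\<forall>i\<in>{..<N}. \<forall>j\<in>{..<N}. distinct [0, i, j] \<longrightarrow> triangle \<sigma> 0 i j = 1"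
    obtain d where d: "\<And>i. i \<in> {..<N} \<Longrightarrow> d i = (1::real) \<or> d i = -1"
      "\<And>i j. i \<in> {..<N} \<Longrightarrow> j \<in> {..<N} \<Longrightarrow> i \<noteq> j \<Longrightarrow> \<sigma> i j = d i * d j"
      by (rule coboundary[OF \<sigma> r]) (use * in auto)
    have "H $$ (i, j) = d i * d j * K $$ (i, j)" if "i < N" "j < N" for i j
      using d(1)[of i] d(2)[of i j] diag[of i] HK[of i j] that by (cases "i = j") auto
    then show ?thesis by (intro principal_minor_sign_conjugate[where d = d, OF K H J]) (use d in auto)
  next
    let ?t = "\<lambda>i j. \<sigma> i j * \<epsilon> i j"
    assume *: "\<forall>i\<in>{..<N}. \<forall>j\<in>{..<N}. distinct [0, i, j] \<longrightarrow> triangle ?t 0 i j = 1"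
    obtain d where d: "\<And>i. i \<in> {..<N} \<Longrightarrow> d i = (1::real) \<or> d i = -1"
      "\<And>i j. i \<in> {..<N} \<Longrightarrow> j \<in> {..<N} \<Longrightarrow> i \<noteq> j \<Longrightarrow> ?t i j = d i * d j"
      by (rule coboundary[OF edge_signs_mult[OF \<sigma> \<epsilon>] r]) (use * in auto)
    have "H $$ (i, j) = d i * d j * transpose_mat K $$ (i, j)" if ij: "i < N" "j < N" for i j
    proof (cases "i = j")
      case True
      then show ?thesis using d(1)[of i] diag[of i] K ij by auto
    next
      case False
      have "\<epsilon> i j * \<epsilon> i j = 1" using edge_signsD(1)[OF \<epsilon>, of i j] ij False by auto
      then have "\<sigma> i j = ?t i j * \<epsilon> i j" by simp
      then show ?thesis using d(2)[of i j] HK[of i j] KT[of i j] K ij False by simp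
    qed
    then have "principal_minor H J = principal_minor (transpose_mat K) J"
      by (intro principal_minor_sign_conjugate[where d = d, OF _ H J]) (use d K in auto)
    then show ?thesis using principal_minor_transpose[OF K J] by simp
  qed
qed

section \<open>Principal minors of size at most four\<close>

text \<open>
  Laplace expansion along the first column, in a form whose smaller matrices are again given by
  functions on indices. It can therefore be iterated by rewriting for a concrete size.\<close>

lemma det_mat_Suc:
  fixes f :: "nat \<times> nat \<Rightarrow> 'a::comm_ring_1"
  shows "det (mat (Suc n) (Suc n) f) = (\<Sum>i<Suc n. f (i, 0) *
    ((-1) ^ i * det (mat n n (\<lambda>(a, b). f (if a < i then a else Suc a, Suc b)))))"
proof -
  have "mat_delete (mat (Suc n) (Suc n) f) i 0 = mat n n (\<lambda>(a, b). f (if a < i then a else Suc a, Suc b))" for i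
    by (intro eq_matI) (auto simp: mat_delete_def)
  then show ?thesis
    by (subst laplace_expansion_column[of _ "Suc n" 0]) (auto simp: cofactor_def)
qed

lemma pick_sorted:
  assumes "sorted_wrt (<) js" "a < length js"
  shows "pick (set js) a = js ! a"
proof -
  have "{x \<in> set js. x < js ! a} = (\<lambda>b. js ! b) ` {..<a}"
  proof (intro equalityI subsetI)
    fix x assume x: "x \<in> {x \<in> set js. x < js ! a}"
    then obtain b where b: "b < length js" "x = js ! b" by (auto simp: in_set_conv_nth)
    have "b < a"
    proof (rule ccontr)
      assume "\<not> b < a"
      then have "js ! a \<le> js ! b" using assms b by (cases "a = b") (auto simp: sorted_wrt_iff_nth_less intro!: less_imp_le)
      then show False using b x by simp
    qed
    then show "x \<in> (\<lambda>b. js ! b) ` {..<a}" using b by auto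
  next
    fix x assume "x \<in> (\<lambda>b. js ! b) ` {..<a}"
    then show "x \<in> {x \<in> set js. x < js ! a}" using assms by (auto simp: sorted_wrt_iff_nth_less)
  qed
  moreover have "inj_on (\<lambda>b. js ! b) {..<a}"
    using assms by (auto simp: inj_on_nth strict_sorted_iff)
  ultimately have "card {x \<in> set js. x < js ! a} = a" by (simp add: card_image)
  then show ?thesis using pick_card_in_set[of "js ! a" "set js"] assms(2) by simp
qed

text \<open>
  The entries of \<^const>\<open>submatrix\<close> are numbered by the increasing enumeration of the
  index set.\<close>

lemma principal_minor_sorted:
  assumes M: "M \<in> carrier_mat N N" and js: "sorted_wrt (<) js" "set js \<subseteq> {..<N}"
  shows "principal_minor M (set js) =
    det (mat (length js) (length js) (\<lambda>(a, b). M $$ (js ! a, js ! b)))"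
proof -
  have "{i. i < N \<and> i \<in> set js} = set js" using js(2) by auto
  then have "submatrix M (set js) (set js) = mat (length js) (length js) (\<lambda>(a, b). M $$ (js ! a, js ! b))"
    using M js distinct_card[of js] by (auto simp: submatrix_def strict_sorted_iff pick_sorted intro!: eq_matI)
  then show ?thesis by (simp add: principal_minor_def)
qed

text \<open>
  The sums of \<open>M\<close> over the oriented Hamiltonian cycles of \<open>{i, j, k}\<close> and
  \<open>{i, j, k, l}\<close>.\<close>

definition hamiltonian_sum3 :: "real mat \<Rightarrow> nat \<Rightarrow> nat \<Rightarrow> nat \<Rightarrow> real" where
  "hamiltonian_sum3 M i j k =
     M $$ (i, j) * M $$ (j, k) * M $$ (k, i) + M $$ (i, k) * M $$ (k, j) * M $$ (j, i)"

definition hamiltonian_sum4 :: "real mat \<Rightarrow> nat \<Rightarrow> nat \<Rightarrow> nat \<Rightarrow> nat \<Rightarrow> real" where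
  "hamiltonian_sum4 M i j k l =
     M $$ (i, j) * M $$ (j, k) * M $$ (k, l) * M $$ (l, i)
     + M $$ (i, l) * M $$ (l, k) * M $$ (k, j) * M $$ (j, i)
     + M $$ (i, j) * M $$ (j, l) * M $$ (l, k) * M $$ (k, i)
     + M $$ (i, k) * M $$ (k, l) * M $$ (l, j) * M $$ (j, i)
     + M $$ (i, k) * M $$ (k, j) * M $$ (j, l) * M $$ (l, i)
     + M $$ (i, l) * M $$ (l, j) * M $$ (j, k) * M $$ (k, i)"

context
  fixes M :: "real mat" and N :: nat
  assumes M: "M \<in> carrier_mat N N"
begin

lemma principal_minor_1: "i < N \<Longrightarrow> principal_minor M {i} = M $$ (i, i)"
  using principal_minor_sorted[OF M, of "[i]"] by (simp add: det_mat_Suc)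

lemma principal_minor_2:
  assumes "i < N" "j < N" "i \<noteq> j"
  shows "principal_minor M {i, j} = M $$ (i, i) * M $$ (j, j) - M $$ (i, j) * M $$ (j, i)"
proof -
  have *: "principal_minor M {i, j} = M $$ (i, i) * M $$ (j, j) - M $$ (i, j) * M $$ (j, i)"
    if "i < j" "j < N" for i j
    using principal_minor_sorted[OF M, of "[i, j]"] that
    by (simp add: det_mat_Suc lessThan_Suc)
  from *[of i j] *[of j i] show ?thesis
    using assms by (cases "i < j") (auto simp: insert_commute mult_ac)
qed

text \<open>
  The minor depends on the index set only, and the right-hand side is symmetric in the three
  indices; this extends the expansion from increasing triples to all of them.\<close>

lemma principal_minor_3:
  assumes "i < N" "j < N" "k < N" "distinct [i, j, k]"
  shows "principal_minor M {i, j, k} = M $$ (i, i) * M $$ (j, j) * M $$ (k, k)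
    - M $$ (i, j) * M $$ (j, i) * M $$ (k, k) - M $$ (i, k) * M $$ (k, i) * M $$ (j, j)
    - M $$ (j, k) * M $$ (k, j) * M $$ (i, i) + hamiltonian_sum3 M i j k" (is "_ = ?f i j k")
proof -
  have *: "principal_minor M {i, j, k} = ?f i j k" if "i < j" "j < k" "k < N" for i j k
    using principal_minor_sorted[OF M, of "[i, j, k]"] that
    by (simp add: det_mat_Suc lessThan_Suc hamiltonian_sum3_def algebra_simps)
  have perm: "?f j i k = ?f i j k" "?f i k j = ?f i j k" for i j k
    by (simp_all add: hamiltonian_sum3_def algebra_simps)
  consider "i < j \<and> j < k" | "i < k \<and> k < j" | "j < i \<and> i < k" | "j < k \<and> k < i"
    | "k < i \<and> i < j" | "k < j \<and> j < i" using assms(4) by force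
  then show ?thesis
  proof cases
    case 1 then show ?thesis using *[of i j k] assms by simp
  next
    case 2 then show ?thesis using *[of i k j] perm(2)[of i k j] assms by (simp add: insert_commute)
  next
    case 3 then show ?thesis using *[of j i k] perm(1)[of j i k] assms by (simp add: insert_commute)
  next
    case 4 then show ?thesis using *[of j k i] perm(2)[of j k i] perm(1)[of j i k] assms by (simp add: insert_commute)
  next
    case 5 then show ?thesis using *[of k i j] perm(1)[of k i j] perm(2)[of i k j] assms by (simp add: insert_commute)
  next
    case 6 then show ?thesis using *[of k j i] perm(1)[of k j i] perm(2)[of j k i] perm(1)[of j i k] assms
      by (simp add: insert_commute)
  qed
qed

lemma principal_minor_4:
  assumes "i < j" "j < k" "k < l" "l < N"
  shows "principal_minor M {i, j, k, l} = M $$ (i, i) * M $$ (j, j) * M $$ (k, k) * M $$ (l, l)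
    - M $$ (i, j) * M $$ (j, i) * M $$ (k, k) * M $$ (l, l)
    - M $$ (i, k) * M $$ (k, i) * M $$ (j, j) * M $$ (l, l)
    - M $$ (i, l) * M $$ (l, i) * M $$ (j, j) * M $$ (k, k)
    - M $$ (j, k) * M $$ (k, j) * M $$ (i, i) * M $$ (l, l)
    - M $$ (j, l) * M $$ (l, j) * M $$ (i, i) * M $$ (k, k)
    - M $$ (k, l) * M $$ (l, k) * M $$ (i, i) * M $$ (j, j)
    + M $$ (i, j) * M $$ (j, i) * (M $$ (k, l) * M $$ (l, k))
    + M $$ (i, k) * M $$ (k, i) * (M $$ (j, l) * M $$ (l, j))
    + M $$ (i, l) * M $$ (l, i) * (M $$ (j, k) * M $$ (k, j))
    + hamiltonian_sum3 M i j k * M $$ (l, l) + hamiltonian_sum3 M i j l * M $$ (k, k)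
    + hamiltonian_sum3 M i k l * M $$ (j, j) + hamiltonian_sum3 M j k l * M $$ (i, i)
    - hamiltonian_sum4 M i j k l"
  using principal_minor_sorted[OF M, of "[i, j, k, l]"] assms
  by (simp add: det_mat_Suc lessThan_Suc hamiltonian_sum3_def hamiltonian_sum4_def algebra_simps)

end

section \<open>Timed computations\<close>

text \<open>
  Rewriting with the equations for \<^const>\<open>result\<close> replaces a program by the function
  that it computes. The number of steps is only bounded where it depends on the data.\<close>

lemma result_simps [simp]:
  "result (ret x) = x" "result (bind_timed m f) = result (f (result m))"
  "result (op1 g m) = g (result m)" "result (op2 h m n) = h (result m) (result n)"
  "result (query a js) = a (set js)"
  for m :: "'a timed"
  by (simp_all add: ret_def bind_timed_def op1_def op2_def tick_def query_def)

lemma steps_simps [simp]: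
  "steps (ret x) = 0" "steps tick = 1"
  "steps (bind_timed m f) = steps m + steps (f (result m))"
  "steps (op1 g m) = Suc (steps m)" "steps (op2 h m n) = Suc (steps m + steps n)"
  "steps (query a js) = Suc (length js)"
  for m :: "'a timed"
  by (simp_all add: ret_def bind_timed_def op1_def op2_def tick_def query_def)

lemma result_arith [simp]:
  "result (m1 + m2) = result m1 + result m2"
  "result (n1 - n2) = result n1 - result n2"
  "result (l1 * l2) = result l1 * result l2"
  by (simp_all add: plus_timed_def minus_timed_def times_timed_def)

lemma steps_arith [simp]:
  "steps (m1 + m2) = Suc (steps m1 + steps m2)"
  "steps (n1 - n2) = Suc (steps n1 + steps n2)"
  "steps (l1 * l2) = Suc (steps l1 + steps l2)"
  by (simp_all add: plus_timed_def minus_timed_def times_timed_def)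

lemma upt_acc [simp]:
  "result (upt_acc_timed n acc) = [0..<n] @ acc" "steps (upt_acc_timed n acc) = Suc n"
proof (induction n arbitrary: acc)
  case 0
  { case 1 show ?case by simp next case 2 show ?case by simp }
next
  case (Suc n)
  { case 1 show ?case using Suc(1)[of "n # acc"] by simp
  next case 2 show ?case using Suc(2)[of "n # acc"] by simp }
qed

lemma append_timed [simp]:
  "result (append_timed xs ys) = xs @ ys" "steps (append_timed xs ys) = Suc (length xs)"
  by (induction xs) auto

lemma result_map_timed [simp]: "result (map_timed f xs) = map (\<lambda>x. result (f x)) xs"
  by (induction xs) auto

lemma steps_map_timed:
  assumes "\<And>x. x \<in> set xs \<Longrightarrow> steps (f x) \<le> B"
  shows "steps (map_timed f xs) \<le> Suc (length xs * Suc B)"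
  using assms by (induction xs) force+

lemma result_concat_map_timed [simp]:
  "result (concat_map_timed f xs) = concat (map (\<lambda>x. result (f x)) xs)"
  by (induction xs) auto

lemma length_concat_map_timed:
  assumes "\<And>x. x \<in> set xs \<Longrightarrow> length (result (f x)) \<le> L"
  shows "length (result (concat_map_timed f xs)) \<le> length xs * L"
  using assms by (induction xs) force+

lemma steps_concat_map_timed:
  assumes "\<And>x. x \<in> set xs \<Longrightarrow> steps (f x) \<le> B"
    and "\<And>x. x \<in> set xs \<Longrightarrow> length (result (f x)) \<le> L"
  shows "steps (concat_map_timed f xs) \<le> Suc (length xs * (B + L + 2))"
  using assms by (induction xs) force+

lemma result_filter_timed [simp]: "result (filter_timed P xs) = filter (\<lambda>x. result (P x)) xs"
  by (induction xs) auto

lemma steps_filter_timed: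
  assumes "\<And>x. x \<in> set xs \<Longrightarrow> steps (P x) \<le> B"
  shows "steps (filter_timed P xs) \<le> Suc (length xs * Suc B)"
  using assms by (induction xs) force+

lemma result_zip_timed [simp]: "result (zip_timed xs ys) = zip xs ys"
  by (induction xs arbitrary: ys) (auto split: list.split)

lemma steps_zip_timed: "steps (zip_timed xs ys) \<le> Suc (length xs)"
  by (induction xs arbitrary: ys) (auto split: list.split)

lemma result_nth_timed [simp]: "n < length xs \<Longrightarrow> result (nth_timed xs n) = xs ! n"
  by (induction xs arbitrary: n) (auto split: nat.split)

lemma steps_nth_timed: "steps (nth_timed xs n) \<le> Suc n"
  by (induction xs arbitrary: n) (auto split: nat.split)

lemma result_member_timed [simp]: "result (member_timed xs y) \<longleftrightarrow> y \<in> set xs"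
  by (induction xs) auto

lemma steps_member_timed: "steps (member_timed xs y) \<le> Suc (2 * length xs)"
  by (induction xs) auto

lemma result_assoc_timed: "map_of ps y = Some z \<Longrightarrow> result (assoc_timed ps y) = z"
  by (induction ps) (auto split: if_splits)

lemma steps_assoc_timed: "steps (assoc_timed ps y) \<le> Suc (2 * length ps)"
  by (induction ps) auto

lemma result_when_timed [simp]: "result (when_timed c m) = (if result c then result m else [])"
  by (simp add: when_timed_def)

lemma steps_when_timed: "steps (when_timed c m) \<le> steps c + steps m"
  by (simp add: when_timed_def)

lemma result_table_timed [simp]:
  "result (table_timed idx f) = map (\<lambda>i. map (\<lambda>j. result (f i j)) idx) idx"
  by (simp add: table_timed_def)

lemma steps_table_timed:
  assumes "\<And>i j. i \<in> set idx \<Longrightarrow> j \<in> set idx \<Longrightarrow> steps (f i j) \<le> B"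
  shows "steps (table_timed idx f) \<le> Suc (length idx * Suc (Suc (length idx * Suc B)))"
  unfolding table_timed_def by (intro steps_map_timed assms)

lemma result_entry_table [simp]:
  "i < n \<Longrightarrow> j < n \<Longrightarrow> result (entry (map (\<lambda>i. map (f i) [0..<n]) [0..<n]) i j) = f i j"
  by (simp add: entry_def)

lemma steps_entry: "steps (entry M i j) \<le> i + j + 2"
  using steps_nth_timed[of M i] steps_nth_timed[of "result (nth_timed M i)" j]
  by (simp add: entry_def)

section \<open>Gaussian elimination\<close>

definition dot :: "bit list \<Rightarrow> bit list \<Rightarrow> bit" where
  "dot cs xs = sum_list (map2 (*) cs xs)"

lemma dot_simps [simp]: "dot [] xs = 0" "dot (c # cs) (x # xs) = c * x + dot cs xs"
  by (simp_all add: dot_def)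

definition solves :: "bit list \<Rightarrow> equation list \<Rightarrow> bool" where
  "solves xs eqs \<longleftrightarrow> (\<forall>(cs, b) \<in> set eqs. dot cs xs = b)"

lemma result_add_coeffs:
  "length cs = length ds \<Longrightarrow> length (result (add_coeffs cs ds)) = length cs"
  "length cs = length ds \<Longrightarrow> length xs = length cs \<Longrightarrow>
    dot (result (add_coeffs cs ds)) xs = dot cs xs + dot ds xs"
proof -
  show "length cs = length ds \<Longrightarrow> length (result (add_coeffs cs ds)) = length cs"
    by (induction cs ds rule: list_induct2) auto
  show "length cs = length ds \<Longrightarrow> length xs = length cs \<Longrightarrow>
    dot (result (add_coeffs cs ds)) xs = dot cs xs + dot ds xs"
  proof (induction cs ds arbitrary: xs rule: list_induct2)
    case (Cons c cs d ds)
    then show ?case by (cases xs) (auto simp: algebra_simps)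
  qed simp
qed

lemma steps_add_coeffs: "steps (add_coeffs cs ds) \<le> Suc (2 * length cs)"
  by (induction cs arbitrary: ds) (auto split: list.split)

lemma result_eval_coeffs:
  "length cs = length sol \<Longrightarrow> result (eval_coeffs cs sol) = dot cs (map snd sol)"
  by (induction cs sol rule: list_induct2) auto

lemma steps_eval_coeffs: "steps (eval_coeffs cs sol) \<le> Suc (3 * length cs)"
  by (induction cs arbitrary: sol) (auto split: list.split)

text \<open>
  Since coefficients lie in the two-element field, the two parts together determine the system.\<close>

lemma split_equations_set:
  assumes "\<forall>r \<in> set eqs. length (fst r) = Suc n" "result (split_equations eqs) = (ones, zeros)"
  shows "set eqs = (\<lambda>(cs, b). (1 # cs, b)) ` set ones \<union> (\<lambda>(cs, b). (0 # cs, b)) ` set zeros"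
  using assms
proof (induction eqs arbitrary: ones zeros)
  case (Cons r eqs)
  obtain os zs where s: "result (split_equations eqs) = (os, zs)" by force
  obtain c cs where r: "fst r = c # cs" using Cons.prems(1) by (cases "fst r") auto
  then have "r = (c # cs, snd r)" by (metis prod.collapse)
  then show ?case using Cons.IH[of os zs] Cons.prems s r by (auto split: if_splits)
qed simp

lemma split_equations_length:
  "result (split_equations eqs) = (ones, zeros) \<Longrightarrow> length ones + length zeros \<le> length eqs"
proof (induction eqs arbitrary: ones zeros)
  case (Cons r eqs)
  obtain os zs where s: "result (split_equations eqs) = (os, zs)" by force
  then show ?case using Cons.IH[of os zs] Cons.prems by (auto split: if_splits list.splits)
qed simp

lemma steps_split_equations: "steps (split_equations eqs) \<le> Suc (2 * length eqs)"
  by (induction eqs) (auto split: list.splits prod.splits)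

lemma gauss_length [simp]: "map fst (result (gauss vs eqs)) = vs"
  by (induction vs arbitrary: eqs) (auto split: list.splits prod.splits)

lemma length_gauss [simp]: "length (result (gauss vs eqs)) = length vs"
  by (metis gauss_length length_map)

text \<open>
  Consistency of the system suffices. Equations without the leading unknown are passed on. The
  others are added to the pivot, which cancels the leading unknown because the characteristic is
  two, and every solution of the original system solves the reduced one. Conversely the value
  computed by back substitution satisfies the pivot, and each of the other equations is the sum of
  the pivot and its reduced form.\<close>

lemma gauss_solves:
  assumes "\<forall>r \<in> set eqs. length (fst r) = length vs" and "length xs = length vs" "solves xs eqs"
  shows "solves (map snd (result (gauss vs eqs))) eqs"
  using assms
proof (induction vs arbitrary: eqs xs)
  case Nil
  then show ?case using Nil.prems(2,3) by simp
next
  case (Cons v vs)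
  obtain ones zeros where s: "result (split_equations eqs) = (ones, zeros)" by force
  have eqs: "set eqs = (\<lambda>(cs, b). (1 # cs, b)) ` set ones \<union> (\<lambda>(cs, b). (0 # cs, b)) ` set zeros"
    using split_equations_set[OF _ s, of "length vs"] Cons.prems(1) by simp
  note IH = Cons.IH
  obtain x ys where xs: "xs = x # ys" "length ys = length vs" using Cons.prems(2) by (cases xs) auto
  have len: "length cs = length vs" if "(cs, b) \<in> set ones \<union> set zeros" for cs b
  proof -
    have "(1 # cs, b) \<in> set eqs \<or> (0 # cs, b) \<in> set eqs"
      using that unfolding eqs by (auto intro: rev_image_eqI)
    then show ?thesis using bspec[OF Cons.prems(1)] by fastforce
  qed
  then have len': "\<forall>r \<in> set ones \<union> set zeros. length (fst r) = length vs"
    by (metis prod.collapse)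
  have solves_iff: "solves (z # zs) eqs \<longleftrightarrow>
      (\<forall>(cs, b) \<in> set ones. z + dot cs zs = b) \<and> solves zs zeros" for z zs
    unfolding solves_def eqs
    by (simp only: ball_Un ball_simps split_def fst_conv snd_conv dot_simps mult_1_left mult_zero_left add_0)
  have ys: "\<And>cs b. (cs, b) \<in> set ones \<Longrightarrow> x + dot cs ys = b" "solves ys zeros"
    using Cons.prems(3) unfolding xs(1) solves_iff by auto
  show ?case
  proof (cases ones)
    case Nil
    have "solves (map snd (result (gauss vs zeros))) zeros"
      by (rule IH[OF _ xs(2) ys(2)]) (use len' in blast)
    then show ?thesis using s Nil by (simp add: solves_iff del: dot_simps)
  next
    case (Cons pivot others)
    obtain p c where p: "pivot = (p, c)" by force
    define rest where "rest = map (\<lambda>r. result (add_equation pivot r)) others @ zeros"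
    define sol where "sol = result (gauss vs rest)"
    define x' where "x' = c + dot p (map snd sol)"
    have lp: "length p = length vs" using len Cons p by auto
    have add_length: "length (fst (result (add_equation pivot r))) = length vs"
      and add_dot: "length zs = length vs \<Longrightarrow>
        dot (fst (result (add_equation pivot r))) zs = dot p zs + dot (fst r) zs"
      and add_snd: "snd (result (add_equation pivot r)) = c + snd r"
      if "r \<in> set others" for r zs
    proof -
      have "length (fst r) = length p" using len' lp that Cons by auto
      then show "length (fst (result (add_equation pivot r))) = length vs"
        and "length zs = length vs \<Longrightarrow>
          dot (fst (result (add_equation pivot r))) zs = dot p zs + dot (fst r) zs"
        and "snd (result (add_equation pivot r)) = c + snd r"
        using lp p result_add_coeffs[of p "fst r"] by (simp_all add: add_equation_def)
    qed
    have cancel: "dot p ys = x + c" "r \<in> set others \<Longrightarrow> dot (fst r) ys = x + snd r" for r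
      using ys(1)[of p c] ys(1)[of "fst r" "snd r"] Cons p by (auto simp: add.assoc[symmetric])
    have rest_length: "length (fst r) = length vs" if "r \<in> set rest" for r
      using that add_length len' unfolding rest_def by auto
    have rest_ys: "dot (fst r) ys = snd r" if "r \<in> set rest" for r
    proof -
      from that consider r' where "r = result (add_equation pivot r')" "r' \<in> set others"
        | "r \<in> set zeros" unfolding rest_def by auto
      then show ?thesis
      proof cases
        case 1
        \<comment> \<open>the leading unknown cancels in characteristic two\<close>
        have "dot (fst r) ys = (x + x) + (c + snd r')"
          unfolding 1(1) add_dot[OF 1(2) xs(2)] cancel(1) cancel(2)[OF 1(2)]
          by (simp only: ac_simps)
        then show ?thesis unfolding 1(1) add_snd[OF 1(2)] by simp
      next
        case 2
        then show ?thesis using ys(2) unfolding solves_def by auto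
      qed
    qed
    have sol: "solves (map snd sol) rest"
      unfolding sol_def
    proof (rule IH[OF _ xs(2)])
      show "\<forall>r \<in> set rest. length (fst r) = length vs" using rest_length by blast
      show "solves ys rest" unfolding solves_def split_def using rest_ys by blast
    qed
    have "x' + dot (fst r) (map snd sol) = snd r" if "r \<in> set others" for r
    proof -
      have "dot p (map snd sol) + dot (fst r) (map snd sol) = c + snd r"
      proof -
        have "result (add_equation pivot r) \<in> set rest" using that by (simp add: rest_def)
        then have "dot (fst (result (add_equation pivot r))) (map snd sol) =
            snd (result (add_equation pivot r))"
          using sol unfolding solves_def split_def by blast
        moreover have "length (map snd sol) = length vs" by (simp add: sol_def)
        ultimately show ?thesis using add_dot[OF that] add_snd[OF that] by metis
      qed
      then have "x' + dot (fst r) (map snd sol) = (c + c) + snd r"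
        unfolding x'_def by (simp only: ac_simps)
      then show ?thesis by simp
    qed
    moreover have "x' + dot p (map snd sol) = c"
    proof -
      have "x' + dot p (map snd sol) = c + (dot p (map snd sol) + dot p (map snd sol))"
        unfolding x'_def by (simp only: ac_simps)
      then show ?thesis by simp
    qed
    ultimately have "\<forall>(cs, b) \<in> set ones. x' + dot cs (map snd sol) = b"
      unfolding Cons p by auto
    moreover have "solves (map snd sol) zeros"
      using sol unfolding solves_def rest_def by auto
    ultimately have "solves (x' # map snd sol) eqs" unfolding solves_iff by blast
    moreover have "result (gauss (v # vs) eqs) = (v, x') # sol"
      using s Cons p lp by (simp add: rest_def sol_def x'_def result_eval_coeffs)
    ultimately show ?thesis by simp
  qed
qed

lemma split_equations_coeff_length:
  assumes "\<forall>r \<in> set eqs. length (fst r) \<le> W" "result (split_equations eqs) = (ones, zeros)"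
  shows "\<forall>r \<in> set ones \<union> set zeros. length (fst r) \<le> W"
  using assms
proof (induction eqs arbitrary: ones zeros)
  case (Cons r eqs)
  obtain os zs where s: "result (split_equations eqs) = (os, zs)" by force
  have "\<forall>r \<in> set os \<union> set zs. length (fst r) \<le> W"
    using Cons.IH[OF _ s] Cons.prems(1) by simp
  then show ?case using s Cons.prems by (simp split: if_splits list.splits) (metis Suc_leD fst_conv insert_iff length_Cons list.set(2) Un_iff)+
qed simp

lemma length_add_coeffs: "length (result (add_coeffs cs ds)) \<le> length cs"
  by (induction cs arbitrary: ds) (auto split: list.splits)

text \<open>
  Neither the number of equations nor their length ever grows, so the cost of eliminating one
  unknown is bounded in terms of the initial system.\<close>

lemma steps_gauss:
  assumes "\<forall>r \<in> set eqs. length (fst r) \<le> W" "length eqs \<le> m"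
  shows "steps (gauss vs eqs) \<le> Suc (length vs * (m * (2 * W + 6) + 3 * W + 8))"
  using assms
proof (induction vs arbitrary: eqs)
  case (Cons v vs)
  obtain ones zeros where s: "result (split_equations eqs) = (ones, zeros)" by force
  note IH = Cons.IH
  note l = split_equations_length[OF s] and w = split_equations_coeff_length[OF Cons.prems(1) s]
  have split: "steps (split_equations eqs) \<le> Suc (2 * m)"
    using steps_split_equations[of eqs] Cons.prems(2) by linarith
  show ?case
  proof (cases ones)
    case Nil
    have "steps (gauss vs zeros) \<le> Suc (length vs * (m * (2 * W + 6) + 3 * W + 8))"
      using Cons.IH[of zeros] w l Cons.prems(2) by auto
    moreover have "steps (gauss (v # vs) eqs) = Suc (steps (split_equations eqs) + steps (gauss vs zeros))"
      using s Nil by simp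
    ultimately show ?thesis using split by (simp add: algebra_simps)
  next
    case (Cons pivot others)
    define rest where "rest = map (\<lambda>r. result (add_equation pivot r)) others @ zeros"
    have p: "length (fst pivot) \<le> W" and lo: "length others \<le> m"
      using w l Cons Cons.prems(2) \<open>length eqs \<le> m\<close> by auto
    have "length (fst (result (add_equation pivot r))) \<le> W" for r
      using length_add_coeffs[of "fst pivot" "fst r"] p by (simp add: add_equation_def)
    then have "steps (gauss vs rest) \<le> Suc (length vs * (m * (2 * W + 6) + 3 * W + 8))"
      by (intro IH) (use w l Cons \<open>length eqs \<le> m\<close> in \<open>auto simp: rest_def\<close>)
    moreover have "steps (add_equation pivot r) \<le> 2 * W + 2" for r
      using steps_add_coeffs[of "fst pivot" "fst r"] p by (simp add: add_equation_def)
    then have "steps (map_timed (add_equation pivot) others) \<le> Suc (length others * Suc (2 * W + 2))"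
      by (intro steps_map_timed)
    then have "steps (map_timed (add_equation pivot) others) \<le> Suc (m * (2 * W + 3))"
      using mult_le_mono1[OF lo, of "2 * W + 3"] by (simp add: algebra_simps)
    moreover have "steps (eval_coeffs (fst pivot) (result (gauss vs rest))) \<le> Suc (3 * W)"
      using steps_eval_coeffs[of "fst pivot" "result (gauss vs rest)"] p by linarith
    moreover have "steps (gauss (v # vs) eqs) = Suc (steps (split_equations eqs) +
        steps (map_timed (add_equation pivot) others) + Suc (length others) +
        steps (gauss vs rest) + Suc (steps (eval_coeffs (fst pivot) (result (gauss vs rest)))))"
      using s Cons by (simp add: rest_def)
    ultimately show ?thesis using split lo by (simp add: algebra_simps)
  qed
qed simp

section \<open>Systems of sign constraints\<close>

definition bit_to_sign :: "bit \<Rightarrow> real" where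
  "bit_to_sign x = (if x = 0 then 1 else -1)"

definition sign_to_bit :: "real \<Rightarrow> bit" where
  "sign_to_bit s = (if s < 0 then 1 else 0)"

lemma result_encode_sign [simp]: "result (encode_sign s) = sign_to_bit s"
  by (simp add: encode_sign_def sign_to_bit_def)

lemma result_decode_sign [simp]: "result (decode_sign x) = bit_to_sign x"
  by (simp add: decode_sign_def bit_to_sign_def)

lemma bit_to_sign_add: "bit_to_sign (x + y) = bit_to_sign x * bit_to_sign y"
  by (cases x; cases y) (auto simp: bit_to_sign_def)

lemma bit_to_sign_sum: "bit_to_sign (sum x A) = (\<Prod>e\<in>A. bit_to_sign (x e))"
proof (induction A rule: infinite_finite_induct)
  case (insert e A)
  then show ?case
    unfolding sum.insert[OF insert.hyps(1,2)] prod.insert[OF insert.hyps(1,2)] bit_to_sign_add by simp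
qed (simp_all add: bit_to_sign_def)

lemma bit_to_sign_inject [simp]: "bit_to_sign x = bit_to_sign y \<longleftrightarrow> x = y"
  by (cases x; cases y) (auto simp: bit_to_sign_def)

lemma bit_to_sign_to_bit: "s = 1 \<or> s = -1 \<Longrightarrow> bit_to_sign (sign_to_bit s) = s"
  by (auto simp: bit_to_sign_def sign_to_bit_def)

lemma bit_to_sign_cases: "bit_to_sign x = 1 \<or> bit_to_sign x = -1"
  by (simp add: bit_to_sign_def)

lemma dot_map: "dot (map f us) (map x us) = (\<Sum>e\<leftarrow>us. f e * x e)"
  by (induction us) (simp_all del: add_bit_eq_xor mult_bit_eq_and)

lemma dot_incidence:
  assumes "distinct us" "set es \<subseteq> set us"
  shows "dot (map (\<lambda>e. if e \<in> set es then 1 else 0) us) (map x us) = (\<Sum>e\<in>set es. x e)"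
proof -
  have "dot (map (\<lambda>e. if e \<in> set es then 1 else 0) us) (map x us) =
      (\<Sum>e\<in>set us. (if e \<in> set es then 1 else 0) * x e)"
    unfolding dot_map using assms(1) by (simp add: sum_list_distinct_conv_sum_set)
  also have "\<dots> = (\<Sum>e\<in>set us. if e \<in> set es then x e else 0)"
    by (intro sum.cong) auto
  also have "\<dots> = (\<Sum>e\<in>set es. x e)"
    using assms(2) by (simp add: sum.If_cases Int_absorb1)
  finally show ?thesis .
qed

text \<open>
  Encoding signs as bits turns products into sums, so a linear equation over the two-element field
  prescribes the product of the signs at the listed positions.\<close>

lemma sign_equation_solution_iff:
  assumes "distinct us" "set es \<subseteq> set us" "s = 1 \<or> s = -1"
  shows "dot (fst (result (sign_equation us es s))) (map x us) = snd (result (sign_equation us es s))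
    \<longleftrightarrow> (\<Prod>e\<in>set es. bit_to_sign (x e)) = s"
proof -
  have "result (sign_equation us es s) = (map (\<lambda>e. if e \<in> set es then 1 else 0) us, sign_to_bit s)"
    by (simp add: sign_equation_def)
  then have "dot (fst (result (sign_equation us es s))) (map x us) = snd (result (sign_equation us es s))
    \<longleftrightarrow> bit_to_sign (\<Sum>e\<in>set es. x e) = bit_to_sign (sign_to_bit s)"
    using dot_incidence[OF assms(1,2)] by simp
  then show ?thesis using bit_to_sign_to_bit[OF assms(3)] by (simp only: bit_to_sign_sum)
qed

definition sign_system :: "('v list \<times> real) list \<Rightarrow> ('v \<Rightarrow> real) \<Rightarrow> bool" where
  "sign_system cons f \<longleftrightarrow> (\<forall>(es, s) \<in> set cons. (\<Prod>e\<in>set es. f e) = s)"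

text \<open>
  If some sign assignment \<open>f\<close> satisfies all the constraints, the one decoded from
  Gaussian elimination does so as well. Below, \<open>f\<close> consists of the signs of the unknown
  kernel.\<close>

lemma gauss_sign_system:
  fixes us :: "(nat \<times> nat) list"
  assumes us: "distinct us"
    and cons: "\<And>es s. (es, s) \<in> set cons \<Longrightarrow> set es \<subseteq> set us \<and> (s = 1 \<or> s = -1)"
    and f: "\<And>e. e \<in> set us \<Longrightarrow> f e = 1 \<or> f e = -1" "sign_system cons f"
  shows "sign_system cons (\<lambda>e. bit_to_sign (result (assoc_timed
    (result (gauss us (map (\<lambda>(es, s). result (sign_equation us es s)) cons))) e)))"
proof -
  define eqs where "eqs = map (\<lambda>(es, s). result (sign_equation us es s)) cons"
  define sol where "sol = result (gauss us eqs)"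
  define x where "x e = result (assoc_timed sol e)" for e
  have solves_iff: "solves (map y us) eqs \<longleftrightarrow> sign_system cons (\<lambda>e. bit_to_sign (y e))" for y
  proof -
    have "(dot (fst (result (sign_equation us es s))) (map y us) = snd (result (sign_equation us es s)))
        \<longleftrightarrow> (\<Prod>e\<in>set es. bit_to_sign (y e)) = s" if "(es, s) \<in> set cons" for es s
      using sign_equation_solution_iff[OF us] cons[OF that] by blast
    then show ?thesis
      unfolding solves_def sign_system_def eqs_def by (auto simp: split_def)
  qed
  have "(\<Prod>e\<in>set es. bit_to_sign (sign_to_bit (f e))) = (\<Prod>e\<in>set es. f e)" if "(es, s) \<in> set cons" for es s
    using cons[OF that] f(1) by (intro prod.cong) (auto intro!: bit_to_sign_to_bit)
  then have "solves (map (\<lambda>e. sign_to_bit (f e)) us) eqs"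
    unfolding solves_iff using f(2) unfolding sign_system_def by auto
  moreover have "\<forall>r\<in>set eqs. length (fst r) = length us"
    by (auto simp: eqs_def sign_equation_def)
  ultimately have "solves (map snd sol) eqs"
    unfolding sol_def by (intro gauss_solves) auto
  moreover have "map snd sol = map x us"
  proof (rule nth_equalityI)
    show l: "length (map snd sol) = length (map x us)" by (simp add: sol_def)
    fix n assume n: "n < length (map snd sol)"
    have keys: "map fst sol = us" by (simp add: sol_def)
    then have "map_of sol (fst (sol ! n)) = Some (snd (sol ! n))"
      using us n by (intro map_of_is_SomeI) auto
    moreover have "fst (sol ! n) = us ! n" using keys n l by (metis length_map nth_map)
    ultimately show "map snd sol ! n = map x us ! n"
      using n l by (simp add: x_def result_assoc_timed)
  qed
  ultimately show ?thesis unfolding eqs_def[symmetric] sol_def[symmetric] x_def[symmetric]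
    using solves_iff[of x] by simp
qed

section \<open>Recovering signs from a signed sum\<close>

definition signed_sum :: "real list \<Rightarrow> real list \<Rightarrow> real" where
  "signed_sum s ms = sum_list (map2 (*) s ms)"

lemma signed_sum_simps [simp]: "signed_sum [] ms = 0"
  "signed_sum (x # s) (m # ms) = x * m + signed_sum s ms"
  by (simp_all add: signed_sum_def)

lemma find_signs_sound:
  "result (find_signs ms p) = Some s \<Longrightarrow>
    length s = length ms \<and> set s \<subseteq> {-1, 1} \<and> signed_sum s ms = p"
proof (induction ms arbitrary: p s)
  case Nil
  then show ?case by (auto split: if_splits)
next
  case (Cons m ms)
  show ?case
  proof (cases "result (find_signs ms (p - m))")
    case None
    then obtain s' where "result (find_signs ms (p + m)) = Some s'" "s = -1 # s'"
      using Cons.prems by (auto split: option.splits)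
    then show ?thesis using Cons.IH[of "p + m" s'] by auto
  next
    case (Some s')
    then show ?thesis using Cons.IH[of "p - m" s'] Cons.prems by auto
  qed
qed

lemma find_signs_complete:
  "length s = length ms \<Longrightarrow> set s \<subseteq> {-1, 1} \<Longrightarrow> result (find_signs ms (signed_sum s ms)) \<noteq> None"
proof (induction s ms rule: list_induct2)
  case (Cons x s m ms)
  then have "signed_sum (x # s) (m # ms) - m = signed_sum s ms \<or>
    signed_sum (x # s) (m # ms) + m = signed_sum s ms" by auto
  then show ?case using Cons by (auto split: option.splits)
qed simp

text \<open>
  Exhaustive search succeeds because the true signs are a solution. It finds no others: the
  difference of two solutions is a relation between the numbers \<open>P c\<close> whose
  coefficients, after division by four, lie in \<open>{-1, 0, 1}\<close>. This is where the
  genericity assumption on the kernel enters.\<close>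

lemma find_signs_unique:
  fixes P :: "'c \<Rightarrow> real"
  assumes "distinct cs" and nz: "\<And>c. c \<in> set cs \<Longrightarrow> P c \<noteq> 0"
    and indep: "\<And>\<eta>. (\<And>c. c \<in> set cs \<Longrightarrow> \<eta> c \<in> {-1, 0, 1}) \<Longrightarrow> (\<Sum>c\<in>set cs. \<eta> c * P c) = 0
      \<Longrightarrow> \<forall>c\<in>set cs. \<eta> c = 0"
  shows "result (find_signs (map (\<lambda>c. 2 * \<bar>P c\<bar>) cs) (\<Sum>c\<leftarrow>cs. 2 * P c)) = Some (map (\<lambda>c. sgn (P c)) cs)"
proof -
  let ?ms = "map (\<lambda>c. 2 * \<bar>P c\<bar>) cs" and ?t = "map (\<lambda>c. sgn (P c)) cs"
  have ssum: "signed_sum (map y cs) ?ms = (\<Sum>c\<in>set cs. y c * (2 * \<bar>P c\<bar>))" for y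
  proof -
    have "signed_sum (map y cs) ?ms = (\<Sum>c\<leftarrow>cs. y c * (2 * \<bar>P c\<bar>))" by (induction cs) auto
    then show ?thesis using assms(1) by (simp only: sum_list_distinct_conv_sum_set)
  qed
  have total: "(\<Sum>c\<leftarrow>cs. 2 * P c) = (\<Sum>c\<in>set cs. sgn (P c) * (2 * \<bar>P c\<bar>))"
    using assms(1) by (auto simp: sum_list_distinct_conv_sum_set sgn_if intro!: sum.cong)
  have "set ?t \<subseteq> {-1, 1}" using nz by (auto simp: sgn_if)
  then have "result (find_signs ?ms (\<Sum>c\<leftarrow>cs. 2 * P c)) \<noteq> None"
    using find_signs_complete[of ?t ?ms] ssum[of "\<lambda>c. sgn (P c)"] total by simp
  then obtain s where s: "result (find_signs ?ms (\<Sum>c\<leftarrow>cs. 2 * P c)) = Some s" by auto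
  then have sp: "length s = length cs" "set s \<subseteq> {-1, 1}" "signed_sum s ?ms = (\<Sum>c\<leftarrow>cs. 2 * P c)"
    using find_signs_sound[OF s] by auto
  define y where "y c = the (map_of (zip cs s) c)" for c
  have sy: "s = map y cs"
    using sp(1) assms(1) by (intro nth_equalityI) (auto simp: y_def map_of_zip_nth)
  \<comment> \<open>the difference to the true sign, expressed relative to \<open>P c\<close> instead of its modulus\<close>
  define \<eta> where "\<eta> c = (y c * sgn (P c) - 1) / 2" for c
  have y: "y c \<in> {-1, 1}" if "c \<in> set cs" for c using sp(2) that unfolding sy by auto
  have "\<forall>c\<in>set cs. \<eta> c = 0"
  proof (rule indep)
    show "\<eta> c \<in> {-1, 0, 1}" if "c \<in> set cs" for c
      using y[OF that] nz[OF that] by (auto simp: \<eta>_def sgn_if)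
    have "(\<Sum>c\<in>set cs. (y c - sgn (P c)) * (2 * \<bar>P c\<bar>)) = 0"
      using sp(3) unfolding sy ssum total by (simp add: algebra_simps sum_subtractf)
    moreover have "(y c - sgn (P c)) * (2 * \<bar>P c\<bar>) = 4 * (\<eta> c * P c)" if "c \<in> set cs" for c
      using nz[OF that] by (auto simp: \<eta>_def sgn_if algebra_simps)
    ultimately have "4 * (\<Sum>c\<in>set cs. \<eta> c * P c) = 0"
      by (simp add: sum_distrib_left)
    then show "(\<Sum>c\<in>set cs. \<eta> c * P c) = 0" by simp
  qed
  then have "y c = sgn (P c)" if "c \<in> set cs" for c
    using y[OF that] nz[OF that] that by (auto simp: \<eta>_def sgn_if split: if_splits)
  then show ?thesis using s unfolding sy by simp
qed

section \<open>Correctness of the algorithm\<close>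

definition cycle_value :: "real mat \<Rightarrow> cycle4 \<Rightarrow> real" where
  "cycle_value K = (\<lambda>(i, j, k, l). K $$ (i, j) * K $$ (j, k) * K $$ (k, l) * K $$ (l, i))"

definition quadrangle :: "(nat \<Rightarrow> nat \<Rightarrow> real) \<Rightarrow> cycle4 \<Rightarrow> real" where
  "quadrangle s = (\<lambda>(i, j, k, l). s i j * s j k * s k l * s l i)"

text \<open>
  The sign function \<open>\<epsilon>\<close> is fixed together with the kernel. It is unique off
  the diagonal because the entries there do not vanish.\<close>

locale generic_kernel =
  fixes N :: nat and K :: "real mat" and a :: "nat set \<Rightarrow> real" and \<epsilon> :: "nat \<Rightarrow> nat \<Rightarrow> real"
  assumes K: "K \<in> carrier_mat N N"
    and minors: "J \<subseteq> {..<N} \<Longrightarrow> a J = principal_minor K J"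
    and \<epsilon>: "edge_signs {..<N} \<epsilon>"
    and transpose: "i < N \<Longrightarrow> j < N \<Longrightarrow> i \<noteq> j \<Longrightarrow> K $$ (j, i) = \<epsilon> i j * K $$ (i, j)"
    and nonzero: "i < N \<Longrightarrow> j < N \<Longrightarrow> i \<noteq> j \<Longrightarrow> K $$ (i, j) \<noteq> 0"
    and generic: "\<lbrakk>i < N; j < N; k < N; l < N; distinct [i, j, k, l];
        \<eta>1 \<in> {-1, 0, 1}; \<eta>2 \<in> {-1, 0, 1}; \<eta>3 \<in> {-1, 0, 1};
        \<eta>1 * cycle_value K (i, j, k, l) + \<eta>2 * cycle_value K (i, j, l, k) + \<eta>3 * cycle_value K (i, k, j, l) = 0\<rbrakk>
      \<Longrightarrow> \<eta>1 = 0 \<and> \<eta>2 = 0 \<and> \<eta>3 = 0"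
begin

lemma \<epsilon>_cases: "i < N \<Longrightarrow> j < N \<Longrightarrow> i \<noteq> j \<Longrightarrow> \<epsilon> i j = 1 \<or> \<epsilon> i j = -1"
  using edge_signsD(1)[OF \<epsilon>, of i j] by simp

lemma \<epsilon>_sym: "i < N \<Longrightarrow> j < N \<Longrightarrow> i \<noteq> j \<Longrightarrow> \<epsilon> j i = \<epsilon> i j"
  using edge_signsD(2)[OF \<epsilon>, of i j] by simp

lemma result_edge_weight:
  assumes "i < N" "j < N" "i \<noteq> j"
  shows "result (edge_weight a i j) = K $$ (i, j) * K $$ (j, i)"
  using assms by (simp add: edge_weight_def minors principal_minor_1[OF K] principal_minor_2[OF K])

lemma result_cycle_sum3:
  assumes "i < N" "j < N" "k < N" "distinct [i, j, k]"
  shows "result (cycle_sum3 a i j k) = hamiltonian_sum3 K i j k"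
  using assms result_edge_weight[of i j] result_edge_weight[of i k] result_edge_weight[of j k]
    principal_minor_3[OF K, of i j k]
  by (simp add: cycle_sum3_def minors principal_minor_1[OF K])

lemma result_cycle_sum4:
  assumes "i < j" "j < k" "k < l" "l < N"
  shows "result (cycle_sum4 a i j k l) = hamiltonian_sum4 K i j k l"
proof -
  have N: "i < N" "j < N" "k < N" "l < N" and d: "i \<noteq> j" "i \<noteq> k" "i \<noteq> l" "j \<noteq> k" "j \<noteq> l" "k \<noteq> l"
    using assms by auto
  have q: "a (set [i]) = K $$ (i, i)" "a (set [j]) = K $$ (j, j)" "a (set [k]) = K $$ (k, k)"
    "a (set [l]) = K $$ (l, l)" "a (set [i, j, k, l]) = principal_minor K {i, j, k, l}"
    using N by (simp_all add: minors principal_minor_1[OF K])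
  have e: "result (edge_weight a i j) = K $$ (i, j) * K $$ (j, i)"
    "result (edge_weight a i k) = K $$ (i, k) * K $$ (k, i)"
    "result (edge_weight a i l) = K $$ (i, l) * K $$ (l, i)"
    "result (edge_weight a j k) = K $$ (j, k) * K $$ (k, j)"
    "result (edge_weight a j l) = K $$ (j, l) * K $$ (l, j)"
    "result (edge_weight a k l) = K $$ (k, l) * K $$ (l, k)"
    using N d by (simp_all add: result_edge_weight)
  have c: "result (cycle_sum3 a i j k) = hamiltonian_sum3 K i j k" "result (cycle_sum3 a i j l) = hamiltonian_sum3 K i j l"
    "result (cycle_sum3 a i k l) = hamiltonian_sum3 K i k l" "result (cycle_sum3 a j k l) = hamiltonian_sum3 K j k l"
    using N d by (simp_all add: result_cycle_sum3)
  show ?thesis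
    unfolding cycle_sum4_def result_arith result_simps q e c principal_minor_4[OF K assms]
    by linarith
qed

definition moduli :: "real list list" where
  "moduli = map (\<lambda>i. map (\<lambda>j. if i = j then 0 else \<bar>K $$ (i, j)\<bar>) [0..<N]) [0..<N]"

definition signs :: "real list list" where
  "signs = map (\<lambda>i. map (\<lambda>j. if i = j then 0 else \<epsilon> i j) [0..<N]) [0..<N]"

lemma entry_moduli [simp]:
  "i < N \<Longrightarrow> j < N \<Longrightarrow> i \<noteq> j \<Longrightarrow> result (entry moduli i j) = \<bar>K $$ (i, j)\<bar>"
  by (simp add: moduli_def)

lemma entry_signs [simp]:
  "i < N \<Longrightarrow> j < N \<Longrightarrow> i \<noteq> j \<Longrightarrow> result (entry signs i j) = \<epsilon> i j"
  by (simp add: signs_def)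

lemma modulus_step_correct: "result (modulus_step a [0..<N]) = moduli"
proof -
  have "sqrt \<bar>K $$ (i, j) * K $$ (j, i)\<bar> = \<bar>K $$ (i, j)\<bar>" if "i < N" "j < N" "i \<noteq> j" for i j
    using transpose[OF that] \<epsilon>_cases[OF that] by (auto simp: abs_mult)
  then show ?thesis
    by (auto simp: modulus_step_def moduli_def result_edge_weight)
qed

lemma sign_step_correct: "result (sign_step a [0..<N]) = signs"
proof -
  have "sgn (K $$ (i, j) * K $$ (j, i)) = \<epsilon> i j" if "i < N" "j < N" "i \<noteq> j" for i j
    using transpose[OF that] \<epsilon>_cases[OF that] nonzero[OF that] by (auto simp: sgn_mult sgn_if)
  then show ?thesis
    by (auto simp: sign_step_def signs_def result_edge_weight)
qed

lemma cycle_prod4_signs: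
  "\<lbrakk>i < N; j < N; k < N; l < N; distinct [i, j, k, l]\<rbrakk>
    \<Longrightarrow> result (cycle_prod4 signs (i, j, k, l)) = quadrangle \<epsilon> (i, j, k, l)"
  by (simp add: cycle_prod4_def quadrangle_def)

lemma cycle_prod4_moduli:
  "\<lbrakk>i < N; j < N; k < N; l < N; distinct [i, j, k, l]\<rbrakk>
    \<Longrightarrow> result (cycle_prod4 moduli (i, j, k, l)) = \<bar>cycle_value K (i, j, k, l)\<bar>"
  by (simp add: cycle_prod4_def cycle_value_def abs_mult)

lemma sgn_cases: "i < N \<Longrightarrow> j < N \<Longrightarrow> i \<noteq> j \<Longrightarrow> sgn (K $$ (i, j)) = 1 \<or> sgn (K $$ (i, j)) = -1"
  using nonzero by (auto simp: sgn_if)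

text \<open>
  Reversing a cycle multiplies its product by its \<open>\<epsilon>\<close>-sign. On a positive
  triangle both orientations therefore contribute equally, and the sign of their sum is that of
  either of them. The extra factor \<open>\<epsilon> i k\<close> replaces the entry at \<open>(k,
  i)\<close> by the one at \<open>(i, k)\<close>.\<close>

lemma triple_sign:
  assumes "i < N" "j < N" "k < N" "distinct [i, j, k]" "triangle \<epsilon> i j k = 1"
  shows "\<epsilon> i k * sgn (hamiltonian_sum3 K i j k) = sgn (K $$ (i, j)) * sgn (K $$ (j, k)) * sgn (K $$ (i, k))"
proof -
  have t: "K $$ (j, i) = \<epsilon> i j * K $$ (i, j)" "K $$ (k, j) = \<epsilon> j k * K $$ (j, k)"
    "K $$ (k, i) = \<epsilon> i k * K $$ (i, k)"
    using transpose[of i j] transpose[of j k] transpose[of i k] assms by simp_all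
  have e: "\<epsilon> i k * \<epsilon> i k = 1" "\<epsilon> i j * \<epsilon> j k = \<epsilon> i k"
    using \<epsilon>_cases[of i k] \<epsilon>_cases[of i j] \<epsilon>_cases[of j k] assms by (auto simp: triangle_def)
  have "hamiltonian_sum3 K i j k = K $$ (i, j) * K $$ (j, k) * K $$ (i, k) * \<epsilon> i k
      + K $$ (i, j) * K $$ (j, k) * K $$ (i, k) * (\<epsilon> i j * \<epsilon> j k)"
    unfolding hamiltonian_sum3_def t by (simp only: ac_simps)
  also have "\<dots> = 2 * (\<epsilon> i k * (K $$ (i, j) * K $$ (j, k) * K $$ (i, k)))"
    unfolding e(2) by simp
  finally have "\<epsilon> i k * sgn (hamiltonian_sum3 K i j k)
      = \<epsilon> i k * sgn (\<epsilon> i k) * (sgn (K $$ (i, j)) * sgn (K $$ (j, k)) * sgn (K $$ (i, k)))"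
    by (simp add: sgn_mult)
  moreover have "\<epsilon> i k * sgn (\<epsilon> i k) = 1" using \<epsilon>_cases[of i k] assms by auto
  ultimately show ?thesis by simp
qed

definition triples where "triples = result (triple_step a [0..<N] signs)"

lemma triples_iff:
  "((i, j, k), s) \<in> set triples \<longleftrightarrow> i < N \<and> j < N \<and> k < N \<and> distinct [i, j, k] \<and>
    triangle \<epsilon> i j k = 1 \<and> s = sgn (K $$ (i, j)) * sgn (K $$ (j, k)) * sgn (K $$ (i, k))"
proof -
  have "((i, j, k), s) \<in> set triples \<longleftrightarrow> i < N \<and> j < N \<and> k < N \<and> distinct [i, j, k] \<and>
      triangle \<epsilon> i j k = 1 \<and> s = \<epsilon> i k * sgn (hamiltonian_sum3 K i j k)"
    by (auto simp: triples_def triple_step_def distinct3_def triangle_def mult_ac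
        result_cycle_sum3 split: if_splits)
  then show ?thesis using triple_sign by metis
qed

definition positive_cycles :: "nat \<Rightarrow> nat \<Rightarrow> nat \<Rightarrow> nat \<Rightarrow> cycle4 list" where
  "positive_cycles i j k l =
     filter (\<lambda>C. quadrangle \<epsilon> C = 1) [(i, j, k, l), (i, j, l, k), (i, k, j, l)]"

text \<open>
  The two orientations of a 4-cycle double on positive cycles and cancel on negative ones.\<close>

lemma hamiltonian_sum4_eq:
  assumes "i < j" "j < k" "k < l" "l < N"
  shows "hamiltonian_sum4 K i j k l = (\<Sum>C\<leftarrow>positive_cycles i j k l. 2 * cycle_value K C)"
proof -
  let ?rev = "\<lambda>p q r s. K $$ (p, s) * K $$ (s, r) * K $$ (r, q) * K $$ (q, p)"
  have both: "cycle_value K (p, q, r, s) + ?rev p q r s =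
      (if quadrangle \<epsilon> (p, q, r, s) = 1 then 2 * cycle_value K (p, q, r, s) else 0)"
    if "p < N" "q < N" "r < N" "s < N" "distinct [p, q, r, s]" for p q r s
  proof -
    have t: "K $$ (q, p) = \<epsilon> p q * K $$ (p, q)" "K $$ (r, q) = \<epsilon> q r * K $$ (q, r)"
      "K $$ (s, r) = \<epsilon> r s * K $$ (r, s)" "K $$ (p, s) = \<epsilon> s p * K $$ (s, p)"
      using transpose[of p q] transpose[of q r] transpose[of r s] transpose[of s p] that by simp_all
    have "?rev p q r s = quadrangle \<epsilon> (p, q, r, s) * cycle_value K (p, q, r, s)"
      unfolding t by (simp add: quadrangle_def cycle_value_def ac_simps)
    moreover have "quadrangle \<epsilon> (p, q, r, s) = 1 \<or> quadrangle \<epsilon> (p, q, r, s) = -1"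
      using \<epsilon>_cases[of p q] \<epsilon>_cases[of q r] \<epsilon>_cases[of r s] \<epsilon>_cases[of s p] that
      by (auto simp: quadrangle_def)
    ultimately show ?thesis by auto
  qed
  have "hamiltonian_sum4 K i j k l = (cycle_value K (i, j, k, l) + ?rev i j k l)
      + (cycle_value K (i, j, l, k) + ?rev i j l k) + (cycle_value K (i, k, j, l) + ?rev i k j l)"
    by (simp add: hamiltonian_sum4_def cycle_value_def)
  then show ?thesis
    using both[of i j k l] both[of i j l k] both[of i k j l] assms by (simp add: positive_cycles_def)
qed

text \<open>
  The moduli and the cycle sum determine the signs, by the uniqueness of the solution of the search.\<close>

lemma quadruple_signs_correct:
  assumes "i < j" "j < k" "k < l" "l < N"
  shows "result (quadruple_signs a moduli signs i j k l) =
    map (\<lambda>C. (C, sgn (cycle_value K C))) (positive_cycles i j k l)"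
proof -
  let ?three = "[(i, j, k, l), (i, j, l, k), (i, k, j, l)]" and ?pos = "positive_cycles i j k l"
  have three: "result (cycle_prod4 signs C) = quadrangle \<epsilon> C"
    "result (cycle_prod4 moduli C) = \<bar>cycle_value K C\<bar>" "cycle_value K C \<noteq> 0" if "C \<in> set ?three" for C
    using that assms by (auto simp: cycle_prod4_signs cycle_prod4_moduli cycle_value_def nonzero)
  have sub: "set ?pos \<subseteq> set ?three" by (auto simp: positive_cycles_def)
  have pos: "filter (\<lambda>C. result (cycle_prod4 signs C) = 1) ?three = ?pos"
    unfolding positive_cycles_def by (rule filter_cong) (simp_all add: three)
  have abs: "map (\<lambda>C. 2 * result (cycle_prod4 moduli C)) ?pos = map (\<lambda>C. 2 * \<bar>cycle_value K C\<bar>) ?pos"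
    using sub three(2) by (intro map_cong) auto
  have search: "result (find_signs (map (\<lambda>C. 2 * \<bar>cycle_value K C\<bar>) ?pos) (hamiltonian_sum4 K i j k l))
      = Some (map (\<lambda>C. sgn (cycle_value K C)) ?pos)"
    unfolding hamiltonian_sum4_eq[OF assms]
  proof (rule find_signs_unique)
    have d: "distinct ?three" using assms by auto
    then show "distinct ?pos" unfolding positive_cycles_def by (rule distinct_filter)
    show "cycle_value K C \<noteq> 0" if "C \<in> set ?pos" for C using that sub three(3) by auto
    fix \<eta> :: "cycle4 \<Rightarrow> real"
    assume \<eta>: "\<And>C. C \<in> set ?pos \<Longrightarrow> \<eta> C \<in> {-1, 0, 1}"
      and sum0: "(\<Sum>C\<in>set ?pos. \<eta> C * cycle_value K C) = 0"
    \<comment> \<open>a relation between the positive cycles is one between all three, with coefficient 0 elsewhere\<close>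
    define \<eta>' where "\<eta>' C = (if C \<in> set ?pos then \<eta> C else 0)" for C
    have "(\<Sum>C\<in>set ?three. \<eta>' C * cycle_value K C) = (\<Sum>C\<in>set ?pos. \<eta>' C * cycle_value K C)"
      using sub by (intro sum.mono_neutral_right) (auto simp: \<eta>'_def)
    also have "\<dots> = 0" using sum0 by (simp add: \<eta>'_def)
    finally have "\<eta>' (i, j, k, l) * cycle_value K (i, j, k, l) + \<eta>' (i, j, l, k) * cycle_value K (i, j, l, k)
        + \<eta>' (i, k, j, l) * cycle_value K (i, k, j, l) = 0"
      using d by simp
    moreover have "\<eta>' C \<in> {-1, 0, 1}" for C using \<eta> by (auto simp: \<eta>'_def)
    ultimately have "\<eta>' (i, j, k, l) = 0 \<and> \<eta>' (i, j, l, k) = 0 \<and> \<eta>' (i, k, j, l) = 0"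
      using assms by (intro generic) auto
    then have zero: "\<eta>' C = 0" if "C \<in> set ?three" for C using that by auto
    show "\<forall>C\<in>set ?pos. \<eta> C = 0"
    proof
      fix C assume C: "C \<in> set ?pos"
      then have "\<eta>' C = 0" using sub by (intro zero) blast
      then show "\<eta> C = 0" using C by (simp add: \<eta>'_def)
    qed
  qed
  have graph: "zip xs (map f xs) = map (\<lambda>C. (C, f C)) xs" for f :: "cycle4 \<Rightarrow> real" and xs
    by (induction xs) auto
  have "result (quadruple_signs a moduli signs i j k l) =
    (case result (find_signs (map (\<lambda>C. 2 * result (cycle_prod4 moduli C))
        (filter (\<lambda>C. result (cycle_prod4 signs C) = 1) ?three)) (result (cycle_sum4 a i j k l))) of
       None \<Rightarrow> [] | Some s \<Rightarrow> zip (filter (\<lambda>C. result (cycle_prod4 signs C) = 1) ?three) s)"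
    unfolding quadruple_signs_def result_simps result_filter_timed result_map_timed result_arith
    by (simp only: result_simps result_zip_timed split: option.split) simp
  also have "\<dots> = map (\<lambda>C. (C, sgn (cycle_value K C))) ?pos"
    unfolding pos abs result_cycle_sum4[OF assms] search by (simp only: option.case graph)
  finally show ?thesis .
qed

definition cycles where "cycles = result (quadruple_step a [0..<N] moduli signs)"

lemma cycles_iff:
  "(C, s) \<in> set cycles \<longleftrightarrow> (\<exists>i j k l. i < j \<and> j < k \<and> k < l \<and> l < N \<and>
    C \<in> set (positive_cycles i j k l) \<and> s = sgn (cycle_value K C))"
proof -
  let ?Q = "\<lambda>i j k l. set (result (quadruple_signs a moduli signs i j k l))"
  have all: "set cycles = (\<Union>i<N. \<Union>j<N. \<Union>k<N. \<Union>l<N. if i < j \<and> j < k \<and> k < l then ?Q i j k l else {})"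
    by (simp add: cycles_def quadruple_step_def increasing4_def atLeast0LessThan if_distrib[of set] cong: if_cong)
  have listed: "(C, s) \<in> set cycles \<longleftrightarrow>
      (\<exists>i j k l. i < j \<and> j < k \<and> k < l \<and> l < N \<and> (C, s) \<in> ?Q i j k l)"
  proof
    assume "(C, s) \<in> set cycles"
    then obtain i j k l where "l < N" and "(C, s) \<in> (if i < j \<and> j < k \<and> k < l then ?Q i j k l else {})"
      unfolding all by blast
    then have "i < j \<and> j < k \<and> k < l \<and> l < N \<and> (C, s) \<in> ?Q i j k l" by (simp split: if_splits)
    then show "\<exists>i j k l. i < j \<and> j < k \<and> k < l \<and> l < N \<and> (C, s) \<in> ?Q i j k l" by blast
  next
    assume "\<exists>i j k l. i < j \<and> j < k \<and> k < l \<and> l < N \<and> (C, s) \<in> ?Q i j k l"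
    then obtain i j k l where *: "i < j" "j < k" "k < l" "l < N" "(C, s) \<in> ?Q i j k l" by blast
    have "(C, s) \<in> (if i < j \<and> j < k \<and> k < l then ?Q i j k l else {})" using * by simp
    moreover have "i < N" "j < N" "k < N" using * by simp_all
    ultimately show "(C, s) \<in> set cycles" unfolding all using \<open>l < N\<close> by blast
  qed
  have one: "(C, s) \<in> set (result (quadruple_signs a moduli signs i j k l)) \<longleftrightarrow>
      C \<in> set (positive_cycles i j k l) \<and> s = sgn (cycle_value K C)"
    if "i < j" "j < k" "k < l" "l < N" for i j k l
    unfolding quadruple_signs_correct[OF that] by auto
  show ?thesis unfolding listed by (intro iff_exI) (simp add: one cong: conj_cong)
qed

definition unknowns :: "(nat \<times> nat) list" where
  "unknowns = concat (map (\<lambda>i. concat (map (\<lambda>j. if i \<noteq> j then [(i, j)] else []) [0..<N])) [0..<N])"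

lemma set_unknowns: "set unknowns = {(i, j). i < N \<and> j < N \<and> i \<noteq> j}"
  by (auto simp: unknowns_def split: if_splits)

lemma distinct_unknowns: "distinct unknowns"
proof -
  have "concat (map (\<lambda>j. if i \<noteq> j then [(i, j)] else []) js) = filter (\<lambda>(i, j). i \<noteq> j) (map (Pair i) js)"
    for i :: nat and js :: "nat list" by (induction js) auto
  then have "unknowns = filter (\<lambda>(i, j). i \<noteq> j) (List.product [0..<N] [0..<N])"
    by (simp add: unknowns_def product_concat_map filter_concat comp_def)
  then show ?thesis by (simp add: distinct_product)
qed

text \<open>
  A constraint consists of a list of positions and the product that the signs at these positions
  must have. The order is that of the equations set up by the algorithm.\<close>

definition constraints :: "((nat \<times> nat) list \<times> real) list" where
  "constraints = map (\<lambda>(i, j). ([(i, j), (j, i)], \<epsilon> i j)) unknowns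
     @ map (\<lambda>((i, j, k), s). ([(i, j), (j, k), (i, k)], s)) triples
     @ map (\<lambda>((i, j, k, l), s). ([(i, j), (j, k), (k, l), (l, i)], s)) cycles"

lemma assignment_step_eq:
  "result (assignment_step [0..<N] signs triples cycles) =
    result (gauss unknowns (map (\<lambda>(es, s). result (sign_equation unknowns es s)) constraints))"
proof -
  have u: "concat (map (\<lambda>i. concat (map (\<lambda>j. if i \<noteq> j then [(i, j)] else []) [0..<N])) [0..<N]) = unknowns"
    by (simp add: unknowns_def)
  have "result (entry signs (fst e) (snd e)) = \<epsilon> (fst e) (snd e)" if "e \<in> set unknowns" for e
    using that by (auto simp: set_unknowns)
  then show ?thesis
    by (simp add: assignment_step_def constraints_def split_def comp_def u cong: if_cong map_cong)
qed

lemma constraints_wf: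
  assumes "(es, s) \<in> set constraints"
  shows "set es \<subseteq> set unknowns \<and> (s = 1 \<or> s = -1)"
proof -
  have sq: "x * y = 1 \<or> x * y = -1" if "x = 1 \<or> x = -1" "y = 1 \<or> y = -1" for x y :: real
    using that by auto
  from assms consider
    i j where "(i, j) \<in> set unknowns" "es = [(i, j), (j, i)]" "s = \<epsilon> i j"
  | i j k where "((i, j, k), s) \<in> set triples" "es = [(i, j), (j, k), (i, k)]"
  | i j k l where "((i, j, k, l), s) \<in> set cycles" "es = [(i, j), (j, k), (k, l), (l, i)]"
    unfolding constraints_def by auto
  then show ?thesis
  proof cases
    case 1
    then show ?thesis using \<epsilon>_cases by (auto simp: set_unknowns)
  next
    case 2
    then have *: "i < N" "j < N" "k < N" "distinct [i, j, k]"
      and s: "s = sgn (K $$ (i, j)) * sgn (K $$ (j, k)) * sgn (K $$ (i, k))"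
      unfolding triples_iff by blast+
    have "s = 1 \<or> s = -1" unfolding s using * by (intro sq sgn_cases) auto
    then show ?thesis using 2(2) * by (auto simp: set_unknowns)
  next
    case 3
    then obtain i' j' k' l' where "i' < j'" "j' < k'" "k' < l'" "l' < N"
      and C: "(i, j, k, l) \<in> set [(i', j', k', l'), (i', j', l', k'), (i', k', j', l')]"
      and "s = sgn (cycle_value K (i, j, k, l))"
      unfolding cycles_iff positive_cycles_def set_filter by blast
    then have *: "i < N" "j < N" "k < N" "l < N" "distinct [i, j, k, l]"
      and s: "s = sgn (K $$ (i, j)) * sgn (K $$ (j, k)) * sgn (K $$ (k, l)) * sgn (K $$ (l, i))"
      by (auto simp: cycle_value_def sgn_mult)
    have "s = 1 \<or> s = -1" unfolding s using * by (intro sq sgn_cases) auto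
    then show ?thesis using 3(2) * by (auto simp: set_unknowns)
  qed
qed

lemma system_iff:
  "sign_system constraints f \<longleftrightarrow>
    (\<forall>i j. i < N \<longrightarrow> j < N \<longrightarrow> i \<noteq> j \<longrightarrow> f (i, j) * f (j, i) = \<epsilon> i j) \<and>
    (\<forall>i j k s. ((i, j, k), s) \<in> set triples \<longrightarrow> f (i, j) * f (j, k) * f (i, k) = s) \<and>
    (\<forall>i j k l s. ((i, j, k, l), s) \<in> set cycles \<longrightarrow> f (i, j) * f (j, k) * f (k, l) * f (l, i) = s)"
proof -
  have 1: "(\<Prod>e\<in>set [(i, j), (j, i)]. f e) = f (i, j) * f (j, i)" if "i \<noteq> j" for i j
    using that by simp
  have 2: "(\<Prod>e\<in>set [(i, j), (j, k), (i, k)]. f e) = f (i, j) * f (j, k) * f (i, k)"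
    if "((i, j, k), s) \<in> set triples" for i j k s
    using that by (auto simp: triples_iff)
  have 3: "(\<Prod>e\<in>set [(i, j), (j, k), (k, l), (l, i)]. f e) = f (i, j) * f (j, k) * f (k, l) * f (l, i)"
    if "((i, j, k, l), s) \<in> set cycles" for i j k l s
  proof -
    have "distinct [i, j, k, l]"
      using that by (auto simp: cycles_iff positive_cycles_def split: if_splits)
    then show ?thesis by (simp add: mult.assoc)
  qed
  have "sign_system constraints f \<longleftrightarrow>
    (\<forall>(i, j) \<in> set unknowns. (\<Prod>e\<in>set [(i, j), (j, i)]. f e) = \<epsilon> i j) \<and>
    (\<forall>((i, j, k), s) \<in> set triples. (\<Prod>e\<in>set [(i, j), (j, k), (i, k)]. f e) = s) \<and>
    (\<forall>((i, j, k, l), s) \<in> set cycles. (\<Prod>e\<in>set [(i, j), (j, k), (k, l), (l, i)]. f e) = s)"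
    unfolding sign_system_def constraints_def set_append set_map ball_Un ball_simps split_def fst_conv snd_conv
    by (rule refl)
  also have "\<dots> \<longleftrightarrow> (\<forall>(i, j) \<in> set unknowns. f (i, j) * f (j, i) = \<epsilon> i j) \<and>
    (\<forall>((i, j, k), s) \<in> set triples. f (i, j) * f (j, k) * f (i, k) = s) \<and>
    (\<forall>((i, j, k, l), s) \<in> set cycles. f (i, j) * f (j, k) * f (k, l) * f (l, i) = s)"
    using 1 2 3 by (intro arg_cong2[of _ _ _ _ "(\<and>)"] ball_cong refl) (auto simp: set_unknowns simp del: set_simps)
  finally show ?thesis by (auto simp: set_unknowns)
qed

definition solution :: "nat \<times> nat \<Rightarrow> real" where
  "solution e = bit_to_sign (result (assoc_timed
     (result (assignment_step [0..<N] signs triples cycles)) e))"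

text \<open>
  The signs of \<open>K\<close> satisfy the constraints, so the system is consistent.\<close>

lemma solution_system: "sign_system constraints solution"
proof -
  let ?f = "\<lambda>(i, j). sgn (K $$ (i, j))"
  have "sign_system constraints ?f"
    unfolding system_iff
  proof (intro conjI allI impI)
    fix i j assume ij: "i < N" "j < N" "i \<noteq> j"
    then show "?f (i, j) * ?f (j, i) = \<epsilon> i j"
      using transpose[OF ij] \<epsilon>_cases[OF ij] nonzero[OF ij] by (auto simp: sgn_if)
  qed (auto simp: triples_iff cycles_iff cycle_value_def sgn_mult)
  moreover have "?f e = 1 \<or> ?f e = -1" if "e \<in> set unknowns" for e
    using that sgn_cases by (auto simp: set_unknowns)
  ultimately show ?thesis
    unfolding solution_def assignment_step_eq
    by (intro gauss_sign_system distinct_unknowns constraints_wf)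
qed

lemma result_algorithm_A:
  "result (algorithm_A N a) = map (\<lambda>i. map (\<lambda>j.
     if i = j then K $$ (i, i) else solution (i, j) * \<bar>K $$ (i, j)\<bar>) [0..<N]) [0..<N]"
proof -
  have "result (nth_timed (result (diagonal_step a [0..<N])) i) = K $$ (i, i)" if "i < N" for i
    using that by (simp add: diagonal_step_def minors principal_minor_1[OF K])
  then show ?thesis
    by (simp add: algorithm_A_def modulus_step_correct sign_step_correct triples_def[symmetric]
        cycles_def[symmetric] solution_def)
qed

text \<open>
  Both the computed signs and those of \<open>K\<close> satisfy the constraints, so their quotient
  \<open>\<sigma>\<close> is \<open>1\<close> on every constrained cycle. Constraints exist for one
  representative of each unoriented positive 4-cycle only. An arbitrary positive 4-cycle is brought
  into that form by a rotation that puts its least vertex first and, if needed, a reversal that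
  makes its second vertex smaller than its fourth.\<close>

lemma matched: "matched_signs {..<N} \<epsilon> (\<lambda>i j. solution (i, j) * sgn (K $$ (i, j)))"
proof -
  define \<sigma> where "\<sigma> i j = solution (i, j) * sgn (K $$ (i, j))" for i j
  note sys = solution_system[unfolded system_iff]
  have sol_cases: "solution e = 1 \<or> solution e = -1" for e
    by (simp add: solution_def bit_to_sign_cases)
  have \<sigma>_sym: "\<sigma> j i = \<sigma> i j" and \<sigma>_cases: "\<sigma> i j = 1 \<or> \<sigma> i j = -1"
    if ij: "i < N" "j < N" "i \<noteq> j" for i j
  proof -
    have "solution (i, j) * solution (j, i) = \<epsilon> i j" using sys ij by blast
    moreover have "sgn (K $$ (j, i)) = \<epsilon> i j * sgn (K $$ (i, j))"
      using transpose[OF ij] \<epsilon>_cases[OF ij] by (auto simp: sgn_mult)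
    ultimately show "\<sigma> j i = \<sigma> i j" "\<sigma> i j = 1 \<or> \<sigma> i j = -1"
      using sol_cases[of "(i, j)"] sol_cases[of "(j, i)"] sgn_cases[OF ij] \<epsilon>_cases[OF ij]
      unfolding \<sigma>_def by auto
  qed
  have unit: "s * s = 1" if "s = 1 \<or> s = -1" for s :: real using that by auto
  have tri: "triangle \<sigma> i j k = 1"
    if "i < N" "j < N" "k < N" "distinct [i, j, k]" "triangle \<epsilon> i j k = 1" for i j k
  proof -
    let ?k = "sgn (K $$ (i, j)) * sgn (K $$ (j, k)) * sgn (K $$ (i, k))"
    have "((i, j, k), ?k) \<in> set triples" using that triples_iff by blast
    then have "solution (i, j) * solution (j, k) * solution (i, k) = ?k" using sys by blast
    then have "triangle \<sigma> i j k = ?k * ?k" by (simp add: triangle_def \<sigma>_def ac_simps)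
    also have "?k * ?k = 1"
      using sgn_cases[of i j] sgn_cases[of j k] sgn_cases[of i k] that by (intro unit) auto
    finally show ?thesis .
  qed
  have listed: "quadrangle \<sigma> C = 1"
    if "i < j" "j < k" "k < l" "l < N" "C \<in> set (positive_cycles i j k l)" for i j k l C
  proof -
    obtain p q r s where C: "C = (p, q, r, s)" by (cases C)
    have d: "p < N" "q < N" "r < N" "s < N" "distinct [p, q, r, s]"
      using that unfolding C by (auto simp: positive_cycles_def split: if_splits)
    let ?k = "sgn (K $$ (p, q)) * sgn (K $$ (q, r)) * sgn (K $$ (r, s)) * sgn (K $$ (s, p))"
    have "(C, ?k) \<in> set cycles"
      unfolding cycles_iff using that by (auto simp: C cycle_value_def sgn_mult)
    then have "solution (p, q) * solution (q, r) * solution (r, s) * solution (s, p) = ?k"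
      using sys C by blast
    then have "quadrangle \<sigma> C = ?k * ?k" by (simp add: C quadrangle_def \<sigma>_def ac_simps)
    also have "?k * ?k = 1"
      using sgn_cases[of p q] sgn_cases[of q r] sgn_cases[of r s] sgn_cases[of s p] d
      by (intro unit) auto
    finally show ?thesis .
  qed
  have turn: "quadrangle t (q, r, s, p) = quadrangle t (p, q, r, s)" for t p q r s
    by (simp add: quadrangle_def ac_simps)
  have flip: "quadrangle t (p, s, r, q) = quadrangle t (p, q, r, s)"
    if "\<And>i j. i < N \<Longrightarrow> j < N \<Longrightarrow> i \<noteq> j \<Longrightarrow> t j i = t i j"
      "p < N" "q < N" "r < N" "s < N" "distinct [p, q, r, s]" for t p q r s
    using that(1)[of p q] that(1)[of q r] that(1)[of r s] that(1)[of s p] that(2-)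
    by (simp add: quadrangle_def ac_simps)
  have least_first: "quadrangle \<sigma> (p, q, r, s) = 1"
    if d: "p < N" "q < N" "r < N" "s < N" "distinct [p, q, r, s]" and pos: "quadrangle \<epsilon> (p, q, r, s) = 1"
      and least: "p < q" "p < r" "p < s" for p q r s
  proof -
    have *: "quadrangle \<sigma> (p, q, r, s) = 1"
      if d: "p < N" "q < N" "r < N" "s < N" "distinct [p, q, r, s]" and pos: "quadrangle \<epsilon> (p, q, r, s) = 1"
        and less: "p < q" "p < r" "q < s" for q s
    proof -
      consider "q < r" "r < s" | "s < r" | "r < q" using d by fastforce
      then show ?thesis
      proof cases
        case 1
        then show ?thesis using listed[of p q r s "(p, q, r, s)"] d pos less
          by (simp add: positive_cycles_def)
      next
        case 2
        then show ?thesis using listed[of p q s r "(p, q, r, s)"] d pos less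
          by (simp add: positive_cycles_def)
      next
        case 3
        then show ?thesis using listed[of p r q s "(p, q, r, s)"] d pos less
          by (simp add: positive_cycles_def)
      qed
    qed
    show ?thesis
    proof (cases "q < s")
      case True
      then show ?thesis using * d pos least by blast
    next
      case False
      then have "quadrangle \<sigma> (p, s, r, q) = 1"
        using *[of s q] d least flip[OF \<epsilon>_sym d] pos by auto
      then show ?thesis using flip[OF \<sigma>_sym d] by simp
    qed
  qed
  have "quadrangle \<sigma> (p, q, r, s) = 1"
    if d: "p < N" "q < N" "r < N" "s < N" "distinct [p, q, r, s]" and pos: "quadrangle \<epsilon> (p, q, r, s) = 1"
    for p q r s
  proof -
    consider "p < q" "p < r" "p < s" | "q < r" "q < s" "q < p" | "r < s" "r < p" "r < q"
      | "s < p" "s < q" "s < r" using d(5) by fastforce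
    then show ?thesis
    proof cases
      case 1
      then show ?thesis using least_first d pos by blast
    next
      case 2
      then show ?thesis using least_first[of q r s p] d pos turn[of _ q r s p] by auto
    next
      case 3
      then show ?thesis using least_first[of r s p q] d pos turn[of _ q r s p] turn[of _ r s p q] by auto
    next
      case 4
      then show ?thesis using least_first[of s p q r] d pos turn[of _ p q r s] by auto
    qed
  qed
  moreover have "edge_signs {..<N} \<sigma>"
    using \<sigma>_sym \<sigma>_cases unfolding edge_signs_def by blast
  ultimately have "matched_signs {..<N} \<epsilon> \<sigma>"
    using \<epsilon> tri by unfold_locales (simp_all only: quadrangle_def split lessThan_iff)
  then show ?thesis unfolding \<sigma>_def .
qed

theorem algorithm_A_correct:
  defines "H \<equiv> mat_of_rows_list N (result (algorithm_A N a))"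
  shows "H \<in> signed_kernels N" and "J \<subseteq> {..<N} \<Longrightarrow> principal_minor H J = principal_minor K J"
proof -
  let ?\<sigma> = "\<lambda>i j. solution (i, j) * sgn (K $$ (i, j))"
  interpret matched_signs "{..<N}" \<epsilon> ?\<sigma> by (rule matched)
  have H: "H \<in> carrier_mat N N"
    by (simp add: H_def result_algorithm_A mat_of_rows_list_def)
  have diag: "H $$ (i, i) = K $$ (i, i)" if "i < N" for i
    using that by (simp add: H_def result_algorithm_A mat_of_rows_list_def)
  have off: "H $$ (i, j) = ?\<sigma> i j * K $$ (i, j)" if "i < N" "j < N" "i \<noteq> j" for i j
    using that by (simp add: H_def result_algorithm_A mat_of_rows_list_def abs_sgn ac_simps)
  show "principal_minor H J = principal_minor K J" if "J \<subseteq> {..<N}"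
    by (rule principal_minors_eq_of_matched_signs[OF K H that matched diag transpose off])
  have HT: "H $$ (j, i) = \<epsilon> i j * H $$ (i, j)" if ij: "i < N" "j < N" "i \<noteq> j" for i j
  proof -
    have "?\<sigma> j i = ?\<sigma> i j" using edge_signsD(2)[OF \<sigma>, of i j] ij by simp
    then show ?thesis using off[OF ij] off[of j i] transpose[OF ij] ij by simp
  qed
  have "\<epsilon> i j \<in> {-1, 1} \<and> \<epsilon> i j = \<epsilon> j i \<and> H $$ (j, i) = \<epsilon> i j * H $$ (i, j)"
    if "i < N" "j < N" "i \<noteq> j" for i j
    using HT[OF that] \<epsilon>_cases[OF that] \<epsilon>_sym[OF that] by auto
  then show "H \<in> signed_kernels N"
    using H unfolding signed_kernels_def by blast
qed

end

section \<open>Running time\<close>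

text \<open>
  The constants in the following bounds are generous.\<close>

definition poly_bounded :: "(nat \<Rightarrow> nat) \<Rightarrow> bool" where
  "poly_bounded f \<longleftrightarrow> (\<exists>p :: nat poly. \<forall>n. f n \<le> poly p n)"

lemma poly_bounded_const: "poly_bounded (\<lambda>n. c)"
  unfolding poly_bounded_def by (intro exI[of _ "[:c:]"]) simp

lemma poly_bounded_id: "poly_bounded (\<lambda>n. n)"
  unfolding poly_bounded_def by (intro exI[of _ "[:0, 1:]"]) simp

lemma poly_bounded_add: "poly_bounded f \<Longrightarrow> poly_bounded g \<Longrightarrow> poly_bounded (\<lambda>n. f n + g n)"
  unfolding poly_bounded_def by (metis add_mono poly_add)

lemma poly_bounded_mult: "poly_bounded f \<Longrightarrow> poly_bounded g \<Longrightarrow> poly_bounded (\<lambda>n. f n * g n)"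
  unfolding poly_bounded_def by (metis mult_le_mono poly_mult)

lemma poly_bounded_Suc: "poly_bounded f \<Longrightarrow> poly_bounded (\<lambda>n. Suc (f n))"
  using poly_bounded_add[OF poly_bounded_const[of 1]] by simp

lemma poly_bounded_power: "poly_bounded f \<Longrightarrow> poly_bounded (\<lambda>n. f n ^ k)"
  by (induction k) (simp_all add: poly_bounded_const poly_bounded_mult)

text \<open>A bound on the cost of \<open>d\<close> nested loops over \<open>N\<close> indices that concatenate lists of length
  at most \<open>L\<close>, each of which is computed in \<open>B\<close> steps.\<close>

primrec loop_cost :: "nat \<Rightarrow> nat \<Rightarrow> nat \<Rightarrow> nat \<Rightarrow> nat" where
  "loop_cost N B L 0 = B"
| "loop_cost N B L (Suc d) = Suc (N * (loop_cost N B L d + L * N ^ d + 2))"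

lemma poly_bounded_loop_cost: "poly_bounded B \<Longrightarrow> poly_bounded (\<lambda>n. loop_cost n (B n) L d)"
  by (induction d) (simp_all add: poly_bounded_Suc poly_bounded_mult poly_bounded_add
      poly_bounded_id poly_bounded_const poly_bounded_power)

lemmas poly_bounded_intros = poly_bounded_const poly_bounded_id poly_bounded_add poly_bounded_mult
  poly_bounded_Suc poly_bounded_power poly_bounded_loop_cost

lemma steps_loop:
  assumes "\<And>i. i < N \<Longrightarrow> steps (f i) \<le> loop_cost N B L d"
    and "\<And>i. i < N \<Longrightarrow> length (result (f i)) \<le> L * N ^ d"
  shows "steps (concat_map_timed f [0..<N]) \<le> loop_cost N B L (Suc d)"
  using steps_concat_map_timed[of "[0..<N]" f "loop_cost N B L d" "L * N ^ d"] assms by simp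

lemma length_loop:
  assumes "\<And>i. i < N \<Longrightarrow> length (result (f i)) \<le> L * N ^ d"
  shows "length (result (concat_map_timed f [0..<N])) \<le> L * N ^ Suc d"
  using length_concat_map_timed[of "[0..<N]" f "L * N ^ d"] assms by (simp add: ac_simps)

lemma steps_entry_le: "i < N \<Longrightarrow> j < N \<Longrightarrow> steps (entry M i j) \<le> 2 * N"
  using steps_entry[of M i j] by linarith

lemma steps_cycle_sum3: "steps (cycle_sum3 a i j k) \<le> 100"
  by (simp add: cycle_sum3_def edge_weight_def)

lemma steps_cycle_sum4: "steps (cycle_sum4 a i j k l) \<le> 1000"
  using steps_cycle_sum3[of a i j k] steps_cycle_sum3[of a i j l]
    steps_cycle_sum3[of a i k l] steps_cycle_sum3[of a j k l]
  by (simp add: cycle_sum4_def edge_weight_def)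

lemma steps_diagonal_step: "steps (diagonal_step a [0..<N]) \<le> Suc (N * 3)"
  using steps_map_timed[of "[0..<N]" "\<lambda>i. query a [i]" 2] by (simp add: diagonal_step_def)

lemma steps_modulus_step: "steps (modulus_step a [0..<N]) \<le> Suc (N * Suc (Suc (N * 14)))"
proof -
  have "steps (modulus_step a [0..<N]) \<le> Suc (length [0..<N] * Suc (Suc (length [0..<N] * Suc 13)))"
    unfolding modulus_step_def
    by (intro steps_table_timed) (simp add: edge_weight_def)
  then show ?thesis by simp
qed

lemma steps_sign_step: "steps (sign_step a [0..<N]) \<le> Suc (N * Suc (Suc (N * 14)))"
proof -
  have "steps (sign_step a [0..<N]) \<le> Suc (length [0..<N] * Suc (Suc (length [0..<N] * Suc 13)))"
    unfolding sign_step_def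
    by (intro steps_table_timed) (simp add: edge_weight_def)
  then show ?thesis by simp
qed

lemma triple_step_bounds:
  "steps (triple_step a [0..<N] E) \<le> loop_cost N (8 * N + 200) 1 3"
  "length (result (triple_step a [0..<N] E)) \<le> N ^ 3"
proof -
  let ?body = "\<lambda>i j k. when_timed (distinct3 i j k)
         (when_timed (op2 (=) (entry E i j * entry E i k * entry E j k) (ret 1))
           (do {s \<leftarrow> entry E i k * op1 sgn (cycle_sum3 a i j k);
                ret [((i, j, k), s)]}))"
  have s: "steps (?body i j k) \<le> loop_cost N (8 * N + 200) 1 0" if "i < N" "j < N" "k < N" for i j k
    using steps_entry_le[of i N j E] steps_entry_le[of i N k E] steps_entry_le[of j N k E]
      steps_cycle_sum3[of a i j k] that
    by (simp add: when_timed_def distinct3_def)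
  have l: "length (result (?body i j k)) \<le> 1 * N ^ 0" for i j k by simp
  have "steps (triple_step a [0..<N] E) \<le> loop_cost N (8 * N + 200) 1 (Suc (Suc (Suc 0)))"
    unfolding triple_step_def by (intro steps_loop length_loop s l)
  then show "steps (triple_step a [0..<N] E) \<le> loop_cost N (8 * N + 200) 1 3"
    by (simp only: numeral_3_eq_3)
  have "length (result (triple_step a [0..<N] E)) \<le> 1 * N ^ Suc (Suc (Suc 0))"
    unfolding triple_step_def by (intro length_loop l)
  then show "length (result (triple_step a [0..<N] E)) \<le> N ^ 3"
    by (simp only: numeral_3_eq_3 mult_1)
qed

text \<open>
  Each element of the list doubles the search. The subtracted constant absorbs the steps spent
  outside the two recursive calls.\<close>

lemma steps_find_signs: "steps (find_signs ms p) \<le> 8 * 2 ^ length ms - 5"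
proof (induction ms arbitrary: p)
  case (Cons m ms)
  have "8 * x - 5 + (8 * x - 5) + 5 \<le> 8 * (2 * x) - 5" if "1 \<le> x" for x :: nat
    using that by linarith
  from this[of "2 ^ length ms"]
  have *: "8 * 2 ^ length ms - 5 + (8 * 2 ^ length ms - 5) + 5 \<le> 8 * 2 ^ length (m # ms) - (5::nat)"
    by simp
  show ?case
    using Cons.IH[of "p - m"] Cons.IH[of "p + m"] * by (simp split: option.splits del: length_Cons)
qed simp

lemma steps_cycle_prod4:
  assumes "i < N" "j < N" "k < N" "l < N"
  shows "steps (cycle_prod4 M (i, j, k, l)) \<le> 8 * N + 3"
  using steps_entry_le[of i N j M] steps_entry_le[of j N k M] steps_entry_le[of k N l M]
    steps_entry_le[of l N i M] assms
  by (simp add: cycle_prod4_def)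

lemma quadruple_signs_bounds:
  assumes ijkl: "i < N" "j < N" "k < N" "l < N"
  shows "steps (quadruple_signs a M E i j k l) \<le> 48 * N + 1150"
    and "length (result (quadruple_signs a M E i j k l)) \<le> 3"
proof -
  let ?three = "[(i, j, k, l), (i, j, l, k), (i, k, j, l)]"
  define pos where "pos = filter (\<lambda>C. result (cycle_prod4 E C) = 1) ?three"
  define ms where "ms = map (\<lambda>C. 2 * result (cycle_prod4 M C)) pos"
  have pos3: "length pos \<le> 3"
    unfolding pos_def using length_filter_le[of _ ?three] by simp
  have prod: "steps (cycle_prod4 A C) \<le> 8 * N + 3" if "C \<in> set ?three" for A C
    using that steps_cycle_prod4 ijkl by auto
  have filt: "steps (filter_timed (\<lambda>C. op2 (=) (cycle_prod4 E C) (ret 1)) ?three)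
      \<le> Suc (length ?three * Suc (8 * N + 4))"
  proof (rule steps_filter_timed)
    show "steps (op2 (=) (cycle_prod4 E C) (ret 1)) \<le> 8 * N + 4" if "C \<in> set ?three" for C
      using prod[OF that, of E] by simp
  qed
  have maps: "steps (map_timed (\<lambda>C. ret 2 * cycle_prod4 M C) pos) \<le> Suc (length pos * Suc (8 * N + 4))"
  proof (rule steps_map_timed)
    show "steps (ret 2 * cycle_prod4 M C) \<le> 8 * N + 4" if "C \<in> set pos" for C
    proof -
      have "C \<in> set ?three" using that filter_is_subset[of _ ?three] unfolding pos_def by blast
      then show ?thesis using prod[of C M] by simp
    qed
  qed
  have pos3': "length pos * Suc (8 * N + 4) \<le> 3 * Suc (8 * N + 4)"
    by (rule mult_le_mono1[OF pos3])
  have find: "steps (find_signs ms p) \<le> 60" for p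
  proof -
    have "(2::nat) ^ length ms \<le> 2 ^ 3" using pos3 by (intro power_increasing) (simp_all add: ms_def)
    then show ?thesis using steps_find_signs[of ms p] by simp
  qed
  have zips: "steps (zip_timed pos s) \<le> 4" for s :: "real list"
    using steps_zip_timed[of pos s] pos3 by simp
  have total: "steps (quadruple_signs a M E i j k l) =
      steps (filter_timed (\<lambda>C. op2 (=) (cycle_prod4 E C) (ret 1)) ?three)
      + (steps (map_timed (\<lambda>C. ret 2 * cycle_prod4 M C) pos) + (steps (cycle_sum4 a i j k l)
      + (steps (find_signs ms (result (cycle_sum4 a i j k l)))
      + (case result (find_signs ms (result (cycle_sum4 a i j k l))) of None \<Rightarrow> 0
          | Some s \<Rightarrow> steps (zip_timed pos s)))))"
    unfolding quadruple_signs_def steps_simps result_filter_timed result_map_timed result_simps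
      result_arith pos_def[symmetric] ms_def[symmetric]
    by (simp split: option.split)
  have zips': "(case r of None \<Rightarrow> 0 | Some s \<Rightarrow> steps (zip_timed pos s)) \<le> 4" for r :: "real list option"
    using zips by (simp split: option.split)
  show "steps (quadruple_signs a M E i j k l) \<le> 48 * N + 1150"
    using filt maps pos3' find[of "result (cycle_sum4 a i j k l)"] steps_cycle_sum4[of a i j k l]
      zips'[of "result (find_signs ms (result (cycle_sum4 a i j k l)))"]
    unfolding total by simp
  show "length (result (quadruple_signs a M E i j k l)) \<le> 3"
    using pos3 unfolding quadruple_signs_def result_simps result_filter_timed result_map_timed
      result_arith pos_def[symmetric]
    by (simp add: min.coboundedI1 split: option.split)
qed

lemma quadruple_step_bounds:
  "steps (quadruple_step a [0..<N] M E) \<le> loop_cost N (48 * N + 1160) 3 4"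
  "length (result (quadruple_step a [0..<N] M E)) \<le> 3 * N ^ 4"
proof -
  have four: "Suc (Suc (Suc (Suc 0))) = 4" by simp
  let ?body = "\<lambda>i j k l. when_timed (increasing4 i j k l) (quadruple_signs a M E i j k l)"
  have s: "steps (?body i j k l) \<le> loop_cost N (48 * N + 1160) 3 0"
    if "i < N" "j < N" "k < N" "l < N" for i j k l
    using quadruple_signs_bounds(1)[OF that, of a M E]
      steps_when_timed[of "increasing4 i j k l" "quadruple_signs a M E i j k l"]
    by (simp add: increasing4_def)
  have l: "length (result (?body i j k l)) \<le> 3 * N ^ 0"
    if "i < N" "j < N" "k < N" "l < N" for i j k l
    using quadruple_signs_bounds(2)[OF that] by simp
  have "steps (quadruple_step a [0..<N] M E) \<le> loop_cost N (48 * N + 1160) 3 (Suc (Suc (Suc (Suc 0))))"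
    unfolding quadruple_step_def by (intro steps_loop length_loop s l)
  then show "steps (quadruple_step a [0..<N] M E) \<le> loop_cost N (48 * N + 1160) 3 4"
    by (simp only: four)
  have "length (result (quadruple_step a [0..<N] M E)) \<le> 3 * N ^ Suc (Suc (Suc (Suc 0)))"
    unfolding quadruple_step_def by (intro length_loop l)
  then show "length (result (quadruple_step a [0..<N] M E)) \<le> 3 * N ^ 4"
    by (simp only: four)
qed

lemma steps_sign_equation:
  assumes "length us \<le> u" "length es \<le> 4"
  shows "steps (sign_equation us es s) \<le> 10 * u + 2"
proof -
  have "steps (map_timed (\<lambda>e. do {b \<leftarrow> member_timed es e; ret (if b then 1 else 0 :: bit)}) us)
      \<le> Suc (length us * Suc 9)"
  proof (rule steps_map_timed)
    show "steps (do {b \<leftarrow> member_timed es e; ret (if b then 1 else 0 :: bit)}) \<le> 9" for e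
      using steps_member_timed[of es e] assms(2) by simp
  qed
  then show ?thesis using assms(1) by (simp add: sign_equation_def encode_sign_def)
qed

definition assignment_cost :: "nat \<Rightarrow> nat" where
  "assignment_cost N = (let u = N ^ 2; t = N ^ 3; c = 3 * N ^ 4; m = u + t + c in
     loop_cost N 1 1 2 + Suc (u * (2 * N + 10 * u + 3)) + Suc (t * (10 * u + 3)) + Suc (c * (10 * u + 3))
     + Suc t + Suc u + Suc (u * (m * (2 * u + 6) + 3 * u + 8)))"

text \<open>
  There are at most \<open>N ^ 2\<close> unknowns, and the symmetry, triangle and 4-cycle equations
  number at most \<open>N ^ 2\<close>, \<open>N ^ 3\<close> and \<open>3 * N ^ 4\<close>.\<close>

lemma assignment_step_bounds:
  assumes t: "length triples \<le> N ^ 3" and c: "length cycles \<le> 3 * N ^ 4"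
  shows "steps (assignment_step [0..<N] E triples cycles) \<le> assignment_cost N"
    and "length (result (assignment_step [0..<N] E triples cycles)) \<le> N ^ 2"
proof -
  define U where "U = concat_map_timed (\<lambda>i. concat_map_timed (\<lambda>j.
           when_timed (op2 (\<noteq>) (ret i) (ret j)) (ret [(i, j)])) [0..<N]) [0..<N]"
  define us where "us = result U"
  let ?u = "N ^ 2" and ?t = "N ^ 3" and ?c = "3 * N ^ 4"
  let ?body = "\<lambda>i j. when_timed (op2 (\<noteq>) (ret i) (ret j)) (ret [(i, j)]) :: (nat \<times> nat) list timed"
  have s: "steps (?body i j) \<le> loop_cost N 1 1 0" for i j by (simp add: when_timed_def)
  have l: "length (result (?body i j)) \<le> 1 * N ^ 0" for i j by simp
  have "steps U \<le> loop_cost N 1 1 (Suc (Suc 0))" "length us \<le> 1 * N ^ Suc (Suc 0)"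
    unfolding us_def U_def by (intro steps_loop length_loop s l)+
  then have U: "steps U \<le> loop_cost N 1 1 2" and u: "length us \<le> ?u"
    by (simp_all only: numeral_2_eq_2 mult_1)
  have us_range: "i < N \<and> j < N" if "(i, j) \<in> set us" for i j
    using that by (auto simp: us_def U_def split: if_splits)
  define S where "S = map_timed (\<lambda>(i, j). do {e \<leftarrow> entry E i j; sign_equation us [(i, j), (j, i)] e}) us"
  define T where "T = map_timed (\<lambda>((i, j, k), s). sign_equation us [(i, j), (j, k), (i, k)] s) triples"
  define C where "C = map_timed (\<lambda>((i, j, k, l), s). sign_equation us [(i, j), (j, k), (k, l), (l, i)] s) cycles"
  have "steps S \<le> Suc (length us * Suc (2 * N + 10 * ?u + 2))"
    unfolding S_def
  proof (rule steps_map_timed)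
    fix e assume e: "e \<in> set us"
    obtain i j where ij: "e = (i, j)" by force
    show "steps (case e of (i, j) \<Rightarrow> do {e \<leftarrow> entry E i j; sign_equation us [(i, j), (j, i)] e})
        \<le> 2 * N + 10 * ?u + 2"
      using steps_entry_le[of i N j E] us_range[of i j] e ij
        steps_sign_equation[OF u, of "[(i, j), (j, i)]" "result (entry E i j)"] by simp
  qed
  then have S: "steps S \<le> Suc (?u * (2 * N + 10 * ?u + 3))"
    using mult_le_mono1[OF u, of "2 * N + 10 * ?u + 3"] by (simp add: algebra_simps)
  have "steps T \<le> Suc (length triples * Suc (10 * ?u + 2))"
    unfolding T_def by (rule steps_map_timed) (simp only: split_def, intro steps_sign_equation u, simp)
  then have T: "steps T \<le> Suc (?t * (10 * ?u + 3))"
    using mult_le_mono1[OF t, of "10 * ?u + 3"] by (simp add: algebra_simps)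
  have "steps C \<le> Suc (length cycles * Suc (10 * ?u + 2))"
    unfolding C_def by (rule steps_map_timed) (simp only: split_def, intro steps_sign_equation u, simp)
  then have C: "steps C \<le> Suc (?c * (10 * ?u + 3))"
    using mult_le_mono1[OF c, of "10 * ?u + 3"] by (simp add: algebra_simps)
  define eqs where "eqs = result S @ result T @ result C"
  have len: "length (result S) = length us" "length (result T) = length triples" "length (result C) = length cycles"
    by (simp_all add: S_def T_def C_def)
  have "\<forall>r\<in>set eqs. length (fst r) \<le> length us"
    by (auto simp: eqs_def S_def T_def C_def sign_equation_def)
  then have "\<forall>r\<in>set eqs. length (fst r) \<le> ?u" using u by force
  moreover have "length eqs \<le> ?u + ?t + ?c" using u t c by (simp add: eqs_def len)
  ultimately have "steps (gauss us eqs) \<le> Suc (length us * ((?u + ?t + ?c) * (2 * ?u + 6) + 3 * ?u + 8))"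
    by (rule steps_gauss)
  then have G: "steps (gauss us eqs) \<le> Suc (?u * ((?u + ?t + ?c) * (2 * ?u + 6) + 3 * ?u + 8))"
    using mult_le_mono1[OF u, of "(?u + ?t + ?c) * (2 * ?u + 6) + 3 * ?u + 8"] by linarith
  have "steps (assignment_step [0..<N] E triples cycles) =
      steps U + (steps S + (steps T + (steps C + (Suc (length triples) + (Suc (length us) + steps (gauss us eqs))))))"
    unfolding assignment_step_def U_def[symmetric] steps_simps us_def[symmetric] S_def[symmetric]
      T_def[symmetric] C_def[symmetric] append_timed len eqs_def by (rule refl)
  then show "steps (assignment_step [0..<N] E triples cycles) \<le> assignment_cost N"
    using U S T C G t u unfolding assignment_cost_def Let_def by linarith
  have "result (assignment_step [0..<N] E triples cycles) = result (gauss us eqs)"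
    unfolding assignment_step_def U_def[symmetric] result_simps us_def[symmetric] S_def[symmetric]
      T_def[symmetric] C_def[symmetric] append_timed eqs_def by (rule refl)
  then show "length (result (assignment_step [0..<N] E triples cycles)) \<le> N ^ 2"
    using u by simp
qed

definition algorithm_cost :: "nat \<Rightarrow> nat" where
  "algorithm_cost N = Suc N + Suc (N * 3) + Suc (N * Suc (Suc (N * 14))) + Suc (N * Suc (Suc (N * 14)))
     + loop_cost N (8 * N + 200) 1 3 + loop_cost N (48 * N + 1160) 3 4 + assignment_cost N
     + Suc (N * Suc (Suc (N * Suc (2 * N ^ 2 + 2 * N + 10))))"

lemma steps_algorithm_A: "steps (algorithm_A N a) \<le> algorithm_cost N"
proof -
  define D where "D = result (diagonal_step a [0..<N])"
  define M where "M = result (modulus_step a [0..<N])"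
  define E where "E = result (sign_step a [0..<N])"
  define T where "T = result (triple_step a [0..<N] E)"
  define C where "C = result (quadruple_step a [0..<N] M E)"
  define sol where "sol = result (assignment_step [0..<N] E T C)"
  note ab = assignment_step_bounds[of T N C E,
      OF triple_step_bounds(2)[of a N E, folded T_def] quadruple_step_bounds(2)[of a N M E, folded C_def]]
  let ?f = "\<lambda>i j. do {b \<leftarrow> op2 (=) (ret i) (ret j);
               if b then nth_timed D i
               else do {x \<leftarrow> assoc_timed sol (i, j); decode_sign x * entry M i j}}"
  have "steps (?f i j) \<le> 2 * N ^ 2 + 2 * N + 10" if "i < N" "j < N" for i j
    using steps_nth_timed[of D i] steps_assoc_timed[of sol "(i, j)"] steps_entry_le[OF that, of M]
      ab(2)[folded sol_def] that
    by (cases "i = j") (simp_all add: decode_sign_def)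
  then have "steps (table_timed [0..<N] ?f) \<le>
      Suc (length [0..<N] * Suc (Suc (length [0..<N] * Suc (2 * N ^ 2 + 2 * N + 10))))"
    by (intro steps_table_timed) auto
  then have "steps (table_timed [0..<N] ?f) \<le> Suc (N * Suc (Suc (N * Suc (2 * N ^ 2 + 2 * N + 10))))"
    by simp
  moreover have "steps (algorithm_A N a) = Suc N + (steps (diagonal_step a [0..<N])
      + (steps (modulus_step a [0..<N]) + (steps (sign_step a [0..<N]) + (steps (triple_step a [0..<N] E)
      + (steps (quadruple_step a [0..<N] M E) + (steps (assignment_step [0..<N] E T C)
      + steps (table_timed [0..<N] ?f)))))))"
    unfolding algorithm_A_def steps_simps upt_acc append_Nil2 D_def[symmetric] M_def[symmetric]
      E_def[symmetric] T_def[symmetric] C_def[symmetric] sol_def[symmetric] by (rule refl)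
  ultimately show ?thesis
    using steps_diagonal_step[of a N] steps_modulus_step[of a N] steps_sign_step[of a N]
      triple_step_bounds(1)[of a N E] quadruple_step_bounds(1)[of a N M E] ab(1)
    unfolding algorithm_cost_def by linarith
qed

lemma algorithm_A_poly_time: obtains p :: "nat poly" where "\<And>N a. steps (algorithm_A N a) \<le> poly p N"
proof -
  have "poly_bounded algorithm_cost"
    unfolding algorithm_cost_def[abs_def] assignment_cost_def Let_def by (intro poly_bounded_intros)
  then show ?thesis
    using that steps_algorithm_A unfolding poly_bounded_def by (meson order_trans)
qed

section \<open>Reconstruction of a kernel from its principal minors\<close>

theorem theorem3:
  shows "\<exists>p :: nat poly. \<forall>(N :: nat) (K :: real mat) (a :: nat set \<Rightarrow> real).
    K \<in> signed_kernels N \<longrightarrow>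
    (\<forall>J \<subseteq> {..<N}. a J = principal_minor K J) \<longrightarrow>
    (\<forall>i<N. \<forall>j<N. i \<noteq> j \<longrightarrow> K $$ (i, j) \<noteq> 0) \<longrightarrow>
    (\<forall>i<N. \<forall>j<N. \<forall>k<N. \<forall>l<N. distinct [i, j, k, l] \<longrightarrow>
      (\<forall>\<eta>\<^sub>1 \<in> {-1, 0, 1}. \<forall>\<eta>\<^sub>2 \<in> {-1, 0, 1}. \<forall>\<eta>\<^sub>3 \<in> {-1, 0, 1}.
        \<eta>\<^sub>1 * K $$ (i, j) * K $$ (j, k) * K $$ (k, l) * K $$ (l, i)
        + \<eta>\<^sub>2 * K $$ (i, j) * K $$ (j, l) * K $$ (l, k) * K $$ (k, i)
        + \<eta>\<^sub>3 * K $$ (i, k) * K $$ (k, j) * K $$ (j, l) * K $$ (l, i) = 0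
        \<longrightarrow> \<eta>\<^sub>1 = 0 \<and> \<eta>\<^sub>2 = 0 \<and> \<eta>\<^sub>3 = 0)) \<longrightarrow>
    (let H = mat_of_rows_list N (result (algorithm_A N a))
     in H \<in> signed_kernels N \<and>
        (\<forall>J \<subseteq> {..<N}. J \<noteq> {} \<longrightarrow> principal_minor H J = principal_minor K J) \<and>
        steps (algorithm_A N a) \<le> poly p N)"
proof -
  obtain p :: "nat poly" where p: "\<And>N a. steps (algorithm_A N a) \<le> poly p N"
    using algorithm_A_poly_time by blast
  show ?thesis
    unfolding Let_def
  proof (intro exI[of _ p] allI impI)
    fix N K a
    assume kernel: "K \<in> signed_kernels N"
      and minors: "\<forall>J \<subseteq> {..<N}. a J = principal_minor K J"
      and nonzero: "\<forall>i<N. \<forall>j<N. i \<noteq> j \<longrightarrow> K $$ (i, j) \<noteq> 0"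
      and generic: "\<forall>i<N. \<forall>j<N. \<forall>k<N. \<forall>l<N. distinct [i, j, k, l] \<longrightarrow>
      (\<forall>\<eta>\<^sub>1 \<in> {-1, 0, 1}. \<forall>\<eta>\<^sub>2 \<in> {-1, 0, 1}. \<forall>\<eta>\<^sub>3 \<in> {-1, 0, 1}.
        \<eta>\<^sub>1 * K $$ (i, j) * K $$ (j, k) * K $$ (k, l) * K $$ (l, i)
        + \<eta>\<^sub>2 * K $$ (i, j) * K $$ (j, l) * K $$ (l, k) * K $$ (k, i)
        + \<eta>\<^sub>3 * K $$ (i, k) * K $$ (k, j) * K $$ (j, l) * K $$ (l, i) = 0
        \<longrightarrow> \<eta>\<^sub>1 = 0 \<and> \<eta>\<^sub>2 = 0 \<and> \<eta>\<^sub>3 = 0)"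
    obtain \<epsilon> where \<epsilon>: "\<forall>i<N. \<forall>j<N. i \<noteq> j \<longrightarrow>
        \<epsilon> i j \<in> {-1, 1} \<and> \<epsilon> i j = \<epsilon> j i \<and> K $$ (j, i) = \<epsilon> i j * K $$ (i, j)"
      and K: "K \<in> carrier_mat N N"
      using kernel unfolding signed_kernels_def by blast
    interpret generic_kernel N K a \<epsilon>
    proof
      show "K \<in> carrier_mat N N" by (rule K)
      show "a J = principal_minor K J" if "J \<subseteq> {..<N}" for J using minors that by blast
      show "edge_signs {..<N} \<epsilon>"
      proof -
        have "\<epsilon> i j \<in> {-1, 1} \<and> \<epsilon> j i = \<epsilon> i j" if "i < N" "j < N" "i \<noteq> j" for i j
          using \<epsilon>[rule_format, OF that] by metis
        then show ?thesis unfolding edge_signs_def by blast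
      qed
      show "K $$ (j, i) = \<epsilon> i j * K $$ (i, j)" if "i < N" "j < N" "i \<noteq> j" for i j
        using \<epsilon> that by blast
      show "K $$ (i, j) \<noteq> 0" if "i < N" "j < N" "i \<noteq> j" for i j using nonzero that by blast
      show "\<eta>1 = 0 \<and> \<eta>2 = 0 \<and> \<eta>3 = 0"
        if range: "i < N" "j < N" "k < N" "l < N" "distinct [i, j, k, l]"
          and \<eta>: "\<eta>1 \<in> {-1, 0, 1}" "\<eta>2 \<in> {-1, 0, 1}" "\<eta>3 \<in> {-1, 0, 1}"
          and relation: "\<eta>1 * cycle_value K (i, j, k, l) + \<eta>2 * cycle_value K (i, j, l, k)
            + \<eta>3 * cycle_value K (i, k, j, l) = 0" for i j k l \<eta>1 \<eta>2 \<eta>3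
      proof -
        have "\<eta>1 * K $$ (i, j) * K $$ (j, k) * K $$ (k, l) * K $$ (l, i)
            + \<eta>2 * K $$ (i, j) * K $$ (j, l) * K $$ (l, k) * K $$ (k, i)
            + \<eta>3 * K $$ (i, k) * K $$ (k, j) * K $$ (j, l) * K $$ (l, i) = 0"
          using relation by (simp add: cycle_value_def mult.assoc)
        then show ?thesis by (rule generic[rule_format, OF range \<eta>])
      qed
    qed
    show "mat_of_rows_list N (result (algorithm_A N a)) \<in> signed_kernels N \<and>
        (\<forall>J \<subseteq> {..<N}. J \<noteq> {} \<longrightarrow>
          principal_minor (mat_of_rows_list N (result (algorithm_A N a))) J = principal_minor K J) \<and>
        steps (algorithm_A N a) \<le> poly p N"
      using algorithm_A_correct p by blast
  qed
qed

end
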